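(* The union of the network classes $\mathcal{N}_{1},\mathcal{N}_2,\mathcal{N}_{3}$, $\mathcal{N}_{5},\mathcal{N}_6,\mathcal{N}_7,\mathcal{N}_8,\mathcal{N}_{9}$, $\mathcal{N}_{10},\mathcal{N}_{11},\mathcal{N}_{12},\mathcal{N}_{13},\mathcal{N}_{14}$ and $\mathcal{N}_{10}^{p},\mathcal{N}_{11}^{p},\mathcal{N}_{12}^{p},\mathcal{N}_{13}^{p},\mathcal{N}_{14}^{p}$ is a generating set for $\mathcal{Z}_{1,2}$.
   Context: **Networks.** One-port networks are built from resistors (impedance $R$), inductors (impedance $Ls$, $L>0$) and capacitors (impedance $1/(Cs)$, $C>0$). A single element is a series-parallel network, and a series or parallel connection of two series-parallel networks is a series-parallel network. A series connection of networks with impedances $Z_1,Z_2$ has impedance $Z_1+Z_2$; a parallel connection has impedance $Z$ with $1/Z=1/Z_1+1/Z_2$, written $Z_1\parallel Z_2$. An expression built with $+$ and $\parallel$ describes the network with the corresponding series and parallel connections. A resistor with resistance $R=0$ is a short circuit, and a resistor with conductance $G=0$ (written $1/G$) is an open circuit. Energy storage elements are the inductors and capacitors. **Transformations.** For a series-parallel network $N$ with impedance $Z(s)$: $N^{i}$ is obtained by replacing inductors with impedance $Xs$ by capacitors with impedance $X/s$ and vice versa (impedance $Z(1/s)$); $N^{d}$ is obtained by interchanging series and parallel connections and inverting the impedance of each element (impedance $1/Z(s)$); $N^{p}=(N^{i})^{d}=(N^{d})^{i}$. For a class $\mathcal{N}$, $\mathcal{N}^{p}=\{N^{p}: N\in\mathcal{N}\}$.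 **Generating sets.** $\mathcal{Z}_{m,n}$ is the set of impedances of series-parallel networks containing at most $m$ capacitors and at most $n$ inductors. $\mathcal{G}$ is a generating set for $\mathcal{Z}_{m,n}$ if (i) $\mathcal{G}$ is a set of series-parallel networks, each containing at most $m+n$ energy storage elements, and (ii) for every $Z\in\mathcal{Z}_{m,n}$ there is a network in $\mathcal{G}$ whose impedance is $Z$. **Network classes.** $\mathcal{N}_k$ is the set of all networks of the form $N_k$ with parameters satisfying: all $R_j\ge 0$, all $G_j\ge 0$, all $C_j,L_j>0$, and additionally $R_2>0$ in $N_5$ and $N_{14}$. - $N_1$: $R_1$. - $N_2$: $R_1+\left(\frac1{G_2}\parallel\frac1{C_1s}\right)$. - $N_3$: $R_1+\left(\frac1{G_2}\parallel L_1s\right)$. - $N_5$: $R_1+\left(L_2s\parallel\left(R_2+\left(\frac1{G_3}\parallel L_1s\right)\right)\right)$. - $N_6$: $R_1+\left(L_1s\parallel\left(R_2+\left(\frac1{G_3}\parallel\frac1{C_1s}\right)\right)\right)$. - $N_7$: $R_1+\left(\frac1{C_1s}\parallel\left(R_2+\left(\frac1{G_3}\parallel L_1s\right)\right)\right)$. - $N_8$: $\frac1{G_1}\parallel\left(\frac1{C_1s}+\left(\frac1{G_2}\parallel(R_3+L_1s)\right)\right)$. - $N_9$: $\frac1{G_1}\parallel\left(L_1s+\left(\frac1{G_2}\parallel\left(R_3+\frac1{C_1s}\right)\right)\right)$. - $N_{10}$: $R_4+\left[(R_5+L_2s)\parallel\left(R_1+\left(L_1s\parallel\left(R_2+\left(\frac1{G_3}\parallel\frac1{C_1s}\right)\right)\right)\right)\right]$.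 - $N_{11}$: $R_4+\left[(R_5+L_2s)\parallel\left(R_1+\left(\frac1{C_1s}\parallel\left(R_2+\left(\frac1{G_3}\parallel L_1s\right)\right)\right)\right)\right]$. - $N_{12}$: $R_4+\left[(R_5+L_2s)\parallel\frac1{G_1}\parallel\left(\frac1{C_1s}+\left(\frac1{G_2}\parallel(R_3+L_1s)\right)\right)\right]$. - $N_{13}$: $R_4+\left[(R_5+L_2s)\parallel\frac1{G_1}\parallel\left(L_1s+\left(\frac1{G_2}\parallel\left(R_3+\frac1{C_1s}\right)\right)\right)\right]$. - $N_{14}$: $R_4+\left[\left(R_5+\frac1{C_1s}\right)\parallel\left(R_1+\left(L_2s\parallel\left(R_2+\left(\frac1{G_3}\parallel L_1s\right)\right)\right)\right)\right]$. *)

theory Defs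
  imports "HOL-Computational_Algebra.Computational_Algebra"
begin

section \<open>Series-parallel networks\<close>

text \<open>
  A resistor is given by its resistance, and the open circuit (the resistor of conductance zero)
  is a separate element, so that resistors range over all resistances from zero to infinity.
  An inductor with parameter \<open>L\<close> has impedance \<open>L s\<close>, a capacitor with parameter \<open>C\<close> has
  impedance \<open>1 / (C s)\<close>.
\<close>

datatype network =
    Resistor real
  | Open_Circuit
  | Inductor real
  | Capacitor real
  | Series network network    (infixl "\<oplus>" 65)
  | Parallel network network  (infixl "\<parallel>" 70)

definition Conductor :: "real \<Rightarrow> network" where
  "Conductor G = (if G = 0 then Open_Circuit else Resistor (1 / G))"

inductive_set series_parallel :: "network set" where
  "R \<ge> 0 \<Longrightarrow> Resistor R \<in> series_parallel"
| "Open_Circuit \<in> series_parallel"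
| "L > 0 \<Longrightarrow> Inductor L \<in> series_parallel"
| "C > 0 \<Longrightarrow> Capacitor C \<in> series_parallel"
| "N \<in> series_parallel \<Longrightarrow> N' \<in> series_parallel \<Longrightarrow> N \<oplus> N' \<in> series_parallel"
| "N \<in> series_parallel \<Longrightarrow> N' \<in> series_parallel \<Longrightarrow> N \<parallel> N' \<in> series_parallel"

primrec num_inductors :: "network \<Rightarrow> nat" where
  "num_inductors (Resistor R) = 0"
| "num_inductors Open_Circuit = 0"
| "num_inductors (Inductor L) = 1"
| "num_inductors (Capacitor C) = 0"
| "num_inductors (N \<oplus> N') = num_inductors N + num_inductors N'"
| "num_inductors (N \<parallel> N') = num_inductors N + num_inductors N'"

primrec num_capacitors :: "network \<Rightarrow> nat" where
  "num_capacitors (Resistor R) = 0"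
| "num_capacitors Open_Circuit = 0"
| "num_capacitors (Inductor L) = 0"
| "num_capacitors (Capacitor C) = 1"
| "num_capacitors (N \<oplus> N') = num_capacitors N + num_capacitors N'"
| "num_capacitors (N \<parallel> N') = num_capacitors N + num_capacitors N'"

definition num_storage :: "network \<Rightarrow> nat" where
  "num_storage N = num_capacitors N + num_inductors N"


section \<open>Impedance\<close>

type_synonym ratfun = "real poly fract"

definition laplace_var :: ratfun where
  "laplace_var = to_fract [:0, 1:]"

definition ratconst :: "real \<Rightarrow> ratfun" where
  "ratconst c = to_fract [:c:]"

text \<open>
  Impedances are real rational functions extended by an infinite value, represented by
  \<open>None\<close>, which is the impedance of an open circuit; \<open>1 / 0\<close> is infinite and \<open>1 / \<infinity>\<close> is zero.
\<close>

fun ext_add :: "ratfun option \<Rightarrow> ratfun option \<Rightarrow> ratfun option" where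
  "ext_add (Some a) (Some b) = Some (a + b)"
| "ext_add _ _ = None"

fun ext_inverse :: "ratfun option \<Rightarrow> ratfun option" where
  "ext_inverse None = Some 0"
| "ext_inverse (Some a) = (if a = 0 then None else Some (1 / a))"

lemma ext_inverse_involution [simp]: "ext_inverse (ext_inverse x) = x"
  by (cases x) auto

primrec impedance :: "network \<Rightarrow> ratfun option" where
  "impedance (Resistor R) = Some (ratconst R)"
| "impedance Open_Circuit = None"
| "impedance (Inductor L) = Some (ratconst L * laplace_var)"
| "impedance (Capacitor C) = Some (1 / (ratconst C * laplace_var))"
| "impedance (N \<oplus> N') = ext_add (impedance N) (impedance N')"
| "impedance (N \<parallel> N') =
     ext_inverse (ext_add (ext_inverse (impedance N)) (ext_inverse (impedance N')))"


section \<open>Generating sets\<close>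

text \<open>Only finite impedances are collected: a network that is an open circuit has none.\<close>

definition impedance_set :: "nat \<Rightarrow> nat \<Rightarrow> ratfun set" where
  "impedance_set m n =
     {Z. \<exists>N \<in> series_parallel. num_capacitors N \<le> m \<and> num_inductors N \<le> n \<and> impedance N = Some Z}"

definition generating_set :: "network set \<Rightarrow> nat \<Rightarrow> nat \<Rightarrow> bool" where
  "generating_set \<G> m n \<longleftrightarrow>
     \<G> \<subseteq> series_parallel \<and> (\<forall>N \<in> \<G>. num_storage N \<le> m + n) \<and>
     (\<forall>Z \<in> impedance_set m n. \<exists>N \<in> \<G>. impedance N = Some Z)"


section \<open>Transformations\<close>

text \<open>
  An inductor of impedance \<open>X s\<close> is exchanged with a capacitor of impedance \<open>X / s\<close>,
  whose capacitance is \<open>1 / X\<close>.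
\<close>

primrec freq_inverse :: "network \<Rightarrow> network" where
  "freq_inverse (Resistor R) = Resistor R"
| "freq_inverse Open_Circuit = Open_Circuit"
| "freq_inverse (Inductor L) = Capacitor (1 / L)"
| "freq_inverse (Capacitor C) = Inductor (1 / C)"
| "freq_inverse (N \<oplus> N') = freq_inverse N \<oplus> freq_inverse N'"
| "freq_inverse (N \<parallel> N') = freq_inverse N \<parallel> freq_inverse N'"

text \<open>
  Inverting \<open>L s\<close> gives \<open>1 / (L s)\<close>, a capacitor with the same parameter, and conversely;
  a short circuit is exchanged with an open circuit.
\<close>

primrec dual :: "network \<Rightarrow> network" where
  "dual (Resistor R) = Conductor R"
| "dual Open_Circuit = Resistor 0"
| "dual (Inductor L) = Capacitor L"
| "dual (Capacitor C) = Inductor C"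
| "dual (N \<oplus> N') = dual N \<parallel> dual N'"
| "dual (N \<parallel> N') = dual N \<oplus> dual N'"

definition p_trans :: "network \<Rightarrow> network" where
  "p_trans N = dual (freq_inverse N)"

lemma p_trans_alt: "p_trans N = freq_inverse (dual N)"
  by (induction N) (simp_all add: p_trans_def Conductor_def)

lemma impedance_dual:
  "N \<in> series_parallel \<Longrightarrow> impedance (dual N) = ext_inverse (impedance N)"
proof (induction rule: series_parallel.induct)
  case (1 R)
  have "ratconst (1 / R) * ratconst R = 1" if "R \<noteq> 0"
    using that by (simp add: ratconst_def flip: to_fract_mult one_pCons)
  then show ?case
    by (auto simp: Conductor_def ratconst_def field_simps)
qed (auto simp: ratconst_def laplace_var_def)


section \<open>Network classes\<close>

definition N1 :: "network set" where
  "N1 = {Resistor R1 | R1. R1 \<ge> 0}"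

definition N2 :: "network set" where
  "N2 = {Resistor R1 \<oplus> (Conductor G2 \<parallel> Capacitor C1) | R1 G2 C1.
     R1 \<ge> 0 \<and> G2 \<ge> 0 \<and> C1 > 0}"

definition N3 :: "network set" where
  "N3 = {Resistor R1 \<oplus> (Conductor G2 \<parallel> Inductor L1) | R1 G2 L1.
     R1 \<ge> 0 \<and> G2 \<ge> 0 \<and> L1 > 0}"

definition N5 :: "network set" where
  "N5 = {Resistor R1 \<oplus> (Inductor L2 \<parallel> (Resistor R2 \<oplus> (Conductor G3 \<parallel> Inductor L1)))
     | R1 L2 R2 G3 L1.
     R1 \<ge> 0 \<and> L2 > 0 \<and> R2 > 0 \<and> G3 \<ge> 0 \<and> L1 > 0}"

definition N6 :: "network set" where
  "N6 = {Resistor R1 \<oplus> (Inductor L1 \<parallel> (Resistor R2 \<oplus> (Conductor G3 \<parallel> Capacitor C1)))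
     | R1 L1 R2 G3 C1.
     R1 \<ge> 0 \<and> L1 > 0 \<and> R2 \<ge> 0 \<and> G3 \<ge> 0 \<and> C1 > 0}"

definition N7 :: "network set" where
  "N7 = {Resistor R1 \<oplus> (Capacitor C1 \<parallel> (Resistor R2 \<oplus> (Conductor G3 \<parallel> Inductor L1)))
     | R1 C1 R2 G3 L1.
     R1 \<ge> 0 \<and> C1 > 0 \<and> R2 \<ge> 0 \<and> G3 \<ge> 0 \<and> L1 > 0}"

definition N8 :: "network set" where
  "N8 = {Conductor G1 \<parallel> (Capacitor C1 \<oplus> (Conductor G2 \<parallel> (Resistor R3 \<oplus> Inductor L1)))
     | G1 C1 G2 R3 L1.
     G1 \<ge> 0 \<and> C1 > 0 \<and> G2 \<ge> 0 \<and> R3 \<ge> 0 \<and> L1 > 0}"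

definition N9 :: "network set" where
  "N9 = {Conductor G1 \<parallel> (Inductor L1 \<oplus> (Conductor G2 \<parallel> (Resistor R3 \<oplus> Capacitor C1)))
     | G1 L1 G2 R3 C1.
     G1 \<ge> 0 \<and> L1 > 0 \<and> G2 \<ge> 0 \<and> R3 \<ge> 0 \<and> C1 > 0}"

definition N10 :: "network set" where
  "N10 = {Resistor R4 \<oplus> ((Resistor R5 \<oplus> Inductor L2) \<parallel>
       (Resistor R1 \<oplus> (Inductor L1 \<parallel> (Resistor R2 \<oplus> (Conductor G3 \<parallel> Capacitor C1)))))
     | R4 R5 L2 R1 L1 R2 G3 C1.
     R4 \<ge> 0 \<and> R5 \<ge> 0 \<and> L2 > 0 \<and> R1 \<ge> 0 \<and> L1 > 0 \<and> R2 \<ge> 0 \<and> G3 \<ge> 0 \<and> C1 > 0}"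

definition N11 :: "network set" where
  "N11 = {Resistor R4 \<oplus> ((Resistor R5 \<oplus> Inductor L2) \<parallel>
       (Resistor R1 \<oplus> (Capacitor C1 \<parallel> (Resistor R2 \<oplus> (Conductor G3 \<parallel> Inductor L1)))))
     | R4 R5 L2 R1 C1 R2 G3 L1.
     R4 \<ge> 0 \<and> R5 \<ge> 0 \<and> L2 > 0 \<and> R1 \<ge> 0 \<and> C1 > 0 \<and> R2 \<ge> 0 \<and> G3 \<ge> 0 \<and> L1 > 0}"

definition N12 :: "network set" where
  "N12 = {Resistor R4 \<oplus> ((Resistor R5 \<oplus> Inductor L2) \<parallel> Conductor G1 \<parallel>
       (Capacitor C1 \<oplus> (Conductor G2 \<parallel> (Resistor R3 \<oplus> Inductor L1))))
     | R4 R5 L2 G1 C1 G2 R3 L1.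
     R4 \<ge> 0 \<and> R5 \<ge> 0 \<and> L2 > 0 \<and> G1 \<ge> 0 \<and> C1 > 0 \<and> G2 \<ge> 0 \<and> R3 \<ge> 0 \<and> L1 > 0}"

definition N13 :: "network set" where
  "N13 = {Resistor R4 \<oplus> ((Resistor R5 \<oplus> Inductor L2) \<parallel> Conductor G1 \<parallel>
       (Inductor L1 \<oplus> (Conductor G2 \<parallel> (Resistor R3 \<oplus> Capacitor C1))))
     | R4 R5 L2 G1 L1 G2 R3 C1.
     R4 \<ge> 0 \<and> R5 \<ge> 0 \<and> L2 > 0 \<and> G1 \<ge> 0 \<and> L1 > 0 \<and> G2 \<ge> 0 \<and> R3 \<ge> 0 \<and> C1 > 0}"

definition N14 :: "network set" where
  "N14 = {Resistor R4 \<oplus> ((Resistor R5 \<oplus> Capacitor C1) \<parallel>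
       (Resistor R1 \<oplus> (Inductor L2 \<parallel> (Resistor R2 \<oplus> (Conductor G3 \<parallel> Inductor L1)))))
     | R4 R5 C1 R1 L2 R2 G3 L1.
     R4 \<ge> 0 \<and> R5 \<ge> 0 \<and> C1 > 0 \<and> R1 \<ge> 0 \<and> L2 > 0 \<and> R2 > 0 \<and> G3 \<ge> 0 \<and> L1 > 0}"

end

theory Submission
  imports Defs "HOL-Library.Extended_Nonnegative_Real"
begin

text \<open>
  At a real \<open>s > 0\<close> every element has an impedance in \<open>[0, \<infinity>]\<close>, so the extended arithmetic is
  that of the nonnegative extended reals, and the values on the positive half-line determine the
  impedance. Two identities drive the reduction of an arbitrary network. First, a resistor in
  series and a conductor in parallel can be exchanged at the cost of rescaling the rest of the
  network; hence resistors can be pushed through a network until they merge. Second, \<open>N \<mapsto> N\<^sup>p\<close>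
  exchanges the two kinds of connection and leaves the number of inductors and of capacitors
  unchanged, so that only one kind of connection has to be considered.

  By induction on the network, the reduction comes down to the connection of an inductor with a
  network with one inductor and one capacitor (\<open>N10\<close> to \<open>N13\<close>), or of a capacitor with a network
  with two inductors (\<open>N14\<close>). The former uses that the networks with one inductor and one
  capacitor are covered by \<open>N6\<close> to \<open>N9\<close>: their biquadratic impedances are regular, that is, the
  real part of the impedance or of the admittance on the imaginary axis is smallest at \<open>0\<close> or
  \<open>\<infinity>\<close>, and each of the four cases belongs to one of the four classes.
\<close>

section \<open>Impedances on the positive half-line\<close>

text \<open>The obstacle is the step to three storage elements. Coefficient conditions settle the
  biquadratic impedances; for degree three they are avoided, and closure under resistors is obtained
  structurally. A branch \<open>Resistor R \<oplus> ((Resistor R' \<oplus> X) \<parallel> Y)\<close>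
  absorbs a series resistor in \<open>R\<close>, and a parallel conductor by exchanging it past
  \<open>R\<close> and merging it into \<open>Y\<close>, provided that the class of \<open>Y\<close>
  is itself closed under parallel conductors. So the branches are closed under both operations, and
  therefore so are their images under \<open>p_trans\<close>; only the union of the two is closed
  under \<open>p_trans\<close> by construction. This is why images under \<open>p_trans\<close> are
  listed for \<open>N10\<close> to \<open>N14\<close> alone. The smaller classes are closed up to
  equivalence: \<open>N6\<close> to \<open>N9\<close> are permuted, and \<open>N5\<close> with its
  degenerate cases is stable by a change of canonical form. Degenerate networks are kept throughout
  as networks with fewer elements.\<close>

primrec val :: "network \<Rightarrow> real \<Rightarrow> ennreal" where
  "val (Resistor R) s = ennreal R"
| "val Open_Circuit s = top"
| "val (Inductor L) s = ennreal (L * s)"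
| "val (Capacitor C) s = ennreal (1 / (C * s))"
| "val (N \<oplus> N') s = val N s + val N' s"
| "val (N \<parallel> N') s = inverse (inverse (val N s) + inverse (val N' s))"

definition eqv :: "network \<Rightarrow> network \<Rightarrow> bool" (infix "\<simeq>" 50) where
  "N \<simeq> M \<longleftrightarrow> (\<forall>s>0. val N s = val M s)"

text \<open>\<open>ratio e x y\<close> says that \<open>(x : y)\<close> are projective coordinates of \<open>e \<in> [0, \<infinity>]\<close>.\<close>

definition ratio :: "ennreal \<Rightarrow> real \<Rightarrow> real \<Rightarrow> bool" where
  "ratio e x y \<longleftrightarrow> 0 \<le> x \<and> 0 \<le> y \<and> 0 < x + y \<and> e = (if y = 0 then top else ennreal (x / y))"

lemma inverse_inverse_ennreal [simp]: "inverse (inverse e) = (e::ennreal)"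
  by (cases e; cases "e = 0") (auto simp: inverse_ennreal)

lemma ratioD: "ratio e x y \<Longrightarrow> 0 \<le> x \<and> 0 \<le> y \<and> 0 < x + y"
  by (simp add: ratio_def)

lemma ratio_exists: "\<exists>x y. ratio e x y"
proof (cases e)
  case (real r)
  then have "ratio e r 1" by (simp add: ratio_def)
  then show ?thesis by blast
next
  case top
  then have "ratio e 1 0" by (simp add: ratio_def)
  then show ?thesis by blast
qed

lemma ratio_eq_iff:
  assumes "ratio e x y" "ratio e' x' y'"
  shows "e = e' \<longleftrightarrow> x * y' = x' * y"
  using assms by (auto simp: ratio_def field_simps)

lemma ratio_eqI: "ratio e x y \<Longrightarrow> ratio e' x' y' \<Longrightarrow> x * y' = x' * y \<Longrightarrow> e = e'"
  using ratio_eq_iff by blast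

lemma ratio_cong:
  assumes "ratio e x y" "x * y' = x' * y" "0 \<le> x'" "0 \<le> y'" "0 < x' + y'"
  shows "ratio e x' y'"
  using assms by (auto simp: ratio_def field_simps)

lemma ratio_inverse:
  assumes "ratio e x y" shows "ratio (inverse e) y x"
  using assms by (auto simp: ratio_def inverse_ennreal)

text \<open>The side condition excludes two infinite summands, for which the formula would give the
  meaningless pair \<open>0 : 0\<close>. In the parallel rule below, the dual condition excludes two
  short circuits.\<close>

lemma ratio_add:
  assumes "ratio e x y" "ratio e' x' y'" "0 < y + y'"
  shows "ratio (e + e') (x * y' + x' * y) (y * y')"
proof -
  have "0 < x * y' + x' * y + y * y'"
    using assms by (cases "y = 0"; cases "y' = 0") (auto simp: ratio_def add_nonneg_pos)
  then show ?thesis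
    using assms by (auto simp: ratio_def add_divide_distrib simp flip: ennreal_plus)
qed

lemma ratio_parallel:
  assumes "ratio e x y" "ratio e' x' y'" "0 < x + x'"
  shows "ratio (inverse (inverse e + inverse e')) (x * x') (y * x' + y' * x)"
  using ratio_inverse[OF ratio_add[OF ratio_inverse[OF assms(1)] ratio_inverse[OF assms(2)] assms(3)]] .

lemma ratio_Resistor: "0 \<le> R \<Longrightarrow> ratio (val (Resistor R) s) R 1"
  by (simp add: ratio_def)

lemma ratio_Conductor: "0 \<le> G \<Longrightarrow> ratio (val (Conductor G) s) 1 G"
  by (simp add: ratio_def Conductor_def)

lemma ratio_Inductor: "0 < L \<Longrightarrow> 0 < s \<Longrightarrow> ratio (val (Inductor L) s) (L * s) 1"
  by (simp add: ratio_def add_pos_pos)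

lemma ratio_Capacitor: "0 < C \<Longrightarrow> 0 < s \<Longrightarrow> ratio (val (Capacitor C) s) 1 (C * s)"
  by (simp add: ratio_def add_pos_pos)

lemma ratio_Resistor_series:
  "0 \<le> R \<Longrightarrow> ratio (val N s) x y \<Longrightarrow> ratio (val (Resistor R \<oplus> N) s) (R * y + x) y"
  using ratio_add[OF ratio_Resistor, of R "val N s" x y s] by (auto dest: ratioD)

lemma ratio_Conductor_parallel:
  "0 \<le> G \<Longrightarrow> ratio (val N s) x y \<Longrightarrow> ratio (val (Conductor G \<parallel> N) s) x (G * x + y)"
  using ratio_parallel[OF ratio_Conductor, of G "val N s" x y s] by (auto dest: ratioD)

lemma ratio_Inductor_series:
  "0 < L \<Longrightarrow> 0 < s \<Longrightarrow> ratio (val N s) x y \<Longrightarrow> ratio (val (Inductor L \<oplus> N) s) (L * s * y + x) y"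
  using ratio_add[OF ratio_Inductor, of L s "val N s" x y] by (auto dest: ratioD)

lemma ratio_Inductor_parallel:
  "0 < L \<Longrightarrow> 0 < s \<Longrightarrow> ratio (val N s) x y \<Longrightarrow> ratio (val (Inductor L \<parallel> N) s) (L * s * x) (x + L * s * y)"
  using ratio_parallel[OF ratio_Inductor, of L s "val N s" x y]
  by (auto dest: ratioD simp: mult_ac add_ac add_pos_nonneg add_nonneg_pos)

lemma ratio_Capacitor_series:
  "0 < C \<Longrightarrow> 0 < s \<Longrightarrow> ratio (val N s) x y \<Longrightarrow> ratio (val (Capacitor C \<oplus> N) s) (y + C * s * x) (C * s * y)"
  using ratio_add[OF ratio_Capacitor, of C s "val N s" x y]
  by (auto dest: ratioD simp: mult_ac add_ac add_pos_nonneg add_nonneg_pos)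

lemma ratio_Capacitor_parallel:
  "0 < C \<Longrightarrow> 0 < s \<Longrightarrow> ratio (val N s) x y \<Longrightarrow> ratio (val (Capacitor C \<parallel> N) s) x (C * s * x + y)"
  using ratio_parallel[OF ratio_Capacitor, of C s "val N s" x y]
  by (auto dest: ratioD simp: mult_ac add_ac add_pos_nonneg add_nonneg_pos)

lemmas ratio_rules =
  ratio_Resistor_series ratio_Conductor_parallel ratio_Inductor_series ratio_Inductor_parallel
  ratio_Capacitor_series ratio_Capacitor_parallel
  ratio_Resistor ratio_Conductor ratio_Inductor ratio_Capacitor

lemma eqvI: "(\<And>s. 0 < s \<Longrightarrow> val N s = val M s) \<Longrightarrow> N \<simeq> M"
  by (simp add: eqv_def)

lemma eqv_refl [simp]: "N \<simeq> N"
  by (simp add: eqv_def)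

lemma eqv_sym: "N \<simeq> M \<Longrightarrow> M \<simeq> N"
  by (simp add: eqv_def)

lemma eqv_trans [trans]: "N \<simeq> M \<Longrightarrow> M \<simeq> K \<Longrightarrow> N \<simeq> K"
  by (simp add: eqv_def)

lemma eqv_series: "N \<simeq> N' \<Longrightarrow> M \<simeq> M' \<Longrightarrow> N \<oplus> M \<simeq> N' \<oplus> M'"
  by (simp add: eqv_def)

lemma eqv_parallel: "N \<simeq> N' \<Longrightarrow> M \<simeq> M' \<Longrightarrow> N \<parallel> M \<simeq> N' \<parallel> M'"
  by (simp add: eqv_def)


section \<open>Values on the half-line determine the impedance\<close>

text \<open>Sums and products stay in this class and nothing cancels: a sum vanishes only if both
  summands do. This keeps numerator and denominator from vanishing together at any
  \<open>s > 0\<close>.\<close>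

definition positive_poly :: "real poly \<Rightarrow> bool" where
  "positive_poly p \<longleftrightarrow> p = 0 \<or> (\<forall>s>0. 0 < poly p s)"

lemma positive_poly_add: "positive_poly p \<Longrightarrow> positive_poly q \<Longrightarrow> positive_poly (p + q)"
  by (auto simp: positive_poly_def add_pos_pos)

lemma positive_poly_mult: "positive_poly p \<Longrightarrow> positive_poly q \<Longrightarrow> positive_poly (p * q)"
  by (auto simp: positive_poly_def)

lemma positive_poly_add_eq_0: "positive_poly p \<Longrightarrow> positive_poly q \<Longrightarrow> p + q = 0 \<longleftrightarrow> p = 0 \<and> q = 0"
proof -
  have "poly (p + q) 1 = poly p 1 + poly q 1" by simp
  then show "positive_poly p \<Longrightarrow> positive_poly q \<Longrightarrow> p + q = 0 \<longleftrightarrow> p = 0 \<and> q = 0"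
    unfolding positive_poly_def by (smt (verit) add_0 poly_0)
qed

definition ext_frac :: "real poly \<Rightarrow> real poly \<Rightarrow> ratfun option" where
  "ext_frac p q = (if q = 0 then None else Some (to_fract p / to_fract q))"

text \<open>A single pair of polynomials carries both readings of a network, the rational function
  and the values on the half-line. It need not be in lowest terms.\<close>

definition represents :: "network \<Rightarrow> real poly \<Rightarrow> real poly \<Rightarrow> bool" where
  "represents N p q \<longleftrightarrow> positive_poly p \<and> positive_poly q \<and> (p \<noteq> 0 \<or> q \<noteq> 0) \<and> impedance N = ext_frac p q
     \<and> (\<forall>s>0. ratio (val N s) (poly p s) (poly q s))"

lemma ext_inverse_frac: "p \<noteq> 0 \<or> q \<noteq> 0 \<Longrightarrow> ext_inverse (ext_frac p q) = ext_frac q p"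
  by (auto simp: ext_frac_def)

lemma ext_add_frac: "ext_add (ext_frac p q) (ext_frac p' q') = ext_frac (p * q' + p' * q) (q * q')"
  by (auto simp: ext_frac_def add_frac_eq simp flip: to_fract_mult to_fract_add)

lemma positive_poly_fractions_add:
  assumes "positive_poly p" "positive_poly q" "p \<noteq> 0 \<or> q \<noteq> 0" "\<forall>s>0. ratio (e s) (poly p s) (poly q s)"
    and "positive_poly p'" "positive_poly q'" "p' \<noteq> 0 \<or> q' \<noteq> 0" "\<forall>s>0. ratio (e' s) (poly p' s) (poly q' s)"
  shows "\<exists>p'' q''. positive_poly p'' \<and> positive_poly q'' \<and> (p'' \<noteq> 0 \<or> q'' \<noteq> 0) \<and>
     ext_add (ext_frac p q) (ext_frac p' q') = ext_frac p'' q'' \<and>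
     (\<forall>s>0. ratio (e s + e' s) (poly p'' s) (poly q'' s))"
proof (cases "q = 0 \<and> q' = 0")
  case True
  \<comment> \<open>Both summands are infinite. The usual formula for a sum of fractions would give
    the pair \<open>0, 0\<close>, so infinity is represented by \<open>1, 0\<close> instead.\<close>
  then have "\<forall>s>0. ratio (e s + e' s) (poly 1 s) (poly 0 s)"
    using assms by (auto simp: ratio_def)
  with True show ?thesis
    by (intro exI[of _ 1] exI[of _ 0]) (auto simp: ext_frac_def positive_poly_def)
next
  case False
  have "\<forall>s>0. ratio (e s + e' s) (poly (p * q' + p' * q) s) (poly (q * q') s)"
  proof (intro allI impI)
    fix s :: real assume s: "0 < s"
    then have "0 < poly q s + poly q' s"
      using False assms unfolding positive_poly_def by (smt (verit) poly_0)
    then show "ratio (e s + e' s) (poly (p * q' + p' * q) s) (poly (q * q') s)"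
      using ratio_add[of "e s" "poly p s" "poly q s" "e' s" "poly p' s" "poly q' s"] assms s by simp
  qed
  moreover have "p * q' + p' * q \<noteq> 0 \<or> q * q' \<noteq> 0"
    using False assms positive_poly_add_eq_0[of "p * q'" "p' * q"] positive_poly_mult by auto
  ultimately show ?thesis
    using assms
    by (intro exI[of _ "p * q' + p' * q"] exI[of _ "q * q'"])
       (auto simp: ext_add_frac intro!: positive_poly_add positive_poly_mult)
qed

lemma represents_exists: "N \<in> series_parallel \<Longrightarrow> \<exists>p q. represents N p q"
proof (induction rule: series_parallel.induct)
  case (1 R)
  then have "represents (Resistor R) [:R:] 1"
    by (auto simp: represents_def positive_poly_def ext_frac_def ratconst_def ratio_def)
  then show ?case by blast
next
  case 2
  have "represents Open_Circuit 1 0"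
    by (auto simp: represents_def positive_poly_def ext_frac_def ratio_def)
  then show ?case by blast
next
  case (3 L)
  then have "represents (Inductor L) [:0, L:] 1"
    by (auto simp: represents_def positive_poly_def ext_frac_def ratconst_def laplace_var_def ratio_def
        mult_ac add_pos_pos simp flip: to_fract_mult)
  then show ?case by blast
next
  case (4 C)
  then have "represents (Capacitor C) 1 [:0, C:]"
    by (auto simp: represents_def positive_poly_def ext_frac_def ratconst_def laplace_var_def ratio_def
        mult_ac add_pos_pos simp flip: to_fract_mult)
  then show ?case by blast
next
  case (5 N N')
  then obtain p q p' q' where "represents N p q" "represents N' p' q'" by blast
  then show ?case
    using positive_poly_fractions_add[of p q "val N" p' q' "val N'"]
    unfolding represents_def by auto
next
  case (6 N N')
  then obtain p q p' q' where *: "represents N p q" "represents N' p' q'" by blast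
  have "\<exists>u v. positive_poly u \<and> positive_poly v \<and> (u \<noteq> 0 \<or> v \<noteq> 0) \<and>
    ext_add (ext_frac q p) (ext_frac q' p') = ext_frac u v \<and>
    (\<forall>s>0. ratio (inverse (val N s) + inverse (val N' s)) (poly u s) (poly v s))"
    by (rule positive_poly_fractions_add) (use * in \<open>auto simp: represents_def intro: ratio_inverse\<close>)
  then obtain u v where "positive_poly u" "positive_poly v" "u \<noteq> 0 \<or> v \<noteq> 0"
    and "ext_add (ext_frac q p) (ext_frac q' p') = ext_frac u v"
    and "\<forall>s>0. ratio (inverse (val N s) + inverse (val N' s)) (poly u s) (poly v s)"
    by blast
  with * have "represents (N \<parallel> N') v u"
    unfolding represents_def by (auto simp: ext_inverse_frac intro: ratio_inverse)
  then show ?case by blast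
qed

text \<open>After cross-multiplication, equal values make one polynomial vanish on an infinite set,
  hence identically. This is the only passage from values back to rational functions.\<close>

lemma eqv_imp_impedance_eq:
  assumes "N \<in> series_parallel" "M \<in> series_parallel" "N \<simeq> M"
  shows "impedance N = impedance M"
proof -
  obtain p q p' q' where N: "represents N p q" and M: "represents M p' q'"
    using represents_exists assms(1,2) by meson
  have "poly (p * q' - p' * q) s = 0" if "0 < s" for s
    using N M assms(3) that ratio_eq_iff[of "val N s" "poly p s" "poly q s" "val M s"]
    unfolding represents_def eqv_def by simp
  then have "{0<..} \<subseteq> {s. poly (p * q' - p' * q) s = 0}" by auto
  moreover have "infinite {0::real<..}" by (rule infinite_Ioi)
  ultimately have "p * q' - p' * q = 0"
    using poly_roots_finite finite_subset by blast
  then have "p * q' = p' * q" by simp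
  then show ?thesis
    using N M unfolding represents_def ext_frac_def
    by (auto simp: frac_eq_eq simp flip: to_fract_mult)
qed

section \<open>Transformations and series-parallel networks\<close>

lemma series_parallel_simps [simp]:
  "Resistor R \<in> series_parallel \<longleftrightarrow> 0 \<le> R"
  "Open_Circuit \<in> series_parallel"
  "Inductor L \<in> series_parallel \<longleftrightarrow> 0 < L"
  "Capacitor C \<in> series_parallel \<longleftrightarrow> 0 < C"
  "N \<oplus> M \<in> series_parallel \<longleftrightarrow> N \<in> series_parallel \<and> M \<in> series_parallel"
  "N \<parallel> M \<in> series_parallel \<longleftrightarrow> N \<in> series_parallel \<and> M \<in> series_parallel"
  by (auto intro: series_parallel.intros elim: series_parallel.cases)

lemma Conductor_series_parallel [simp]: "0 \<le> G \<Longrightarrow> Conductor G \<in> series_parallel"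
  by (simp add: Conductor_def)

lemma val_Conductor [simp]: "0 \<le> G \<Longrightarrow> val (Conductor G) s = inverse (ennreal G)"
  by (auto simp: Conductor_def inverse_ennreal inverse_eq_divide)

lemma parallel_assoc: "N \<parallel> M \<parallel> K \<simeq> N \<parallel> (M \<parallel> K)"
  by (simp add: eqv_def add_ac)

lemma parallel_left_commute: "N \<parallel> (M \<parallel> K) \<simeq> M \<parallel> (N \<parallel> K)"
  by (simp add: eqv_def add_ac)

lemma Resistor_merge: "0 \<le> R \<Longrightarrow> 0 \<le> R' \<Longrightarrow> Resistor R \<oplus> (Resistor R' \<oplus> N) \<simeq> Resistor (R + R') \<oplus> N"
  by (simp add: eqv_def add_ac)

lemma Conductor_merge:
  "0 \<le> G \<Longrightarrow> 0 \<le> G' \<Longrightarrow> Conductor G \<parallel> (Conductor G' \<parallel> N) \<simeq> Conductor (G + G') \<parallel> N"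
  by (simp add: eqv_def add_ac)

lemma freq_inverse_Conductor [simp]: "freq_inverse (Conductor G) = Conductor G"
  by (simp add: Conductor_def)

lemma p_trans_simps [simp]:
  "p_trans (Resistor R) = Conductor R"
  "p_trans Open_Circuit = Resistor 0"
  "p_trans (Inductor L) = Inductor (1 / L)"
  "p_trans (Capacitor C) = Capacitor (1 / C)"
  "p_trans (N \<oplus> M) = p_trans N \<parallel> p_trans M"
  "p_trans (N \<parallel> M) = p_trans N \<oplus> p_trans M"
  by (simp_all add: p_trans_def)

lemma Conductor_0 [simp]: "Conductor 0 = Open_Circuit"
  by (simp add: Conductor_def)

lemma p_trans_Conductor [simp]: "p_trans (Conductor G) = Resistor G"
  by (simp add: p_trans_def Conductor_def)

lemma p_trans_p_trans [simp]: "p_trans (p_trans N) = N"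
  by (induction N) auto

lemma freq_inverse_freq_inverse [simp]: "freq_inverse (freq_inverse N) = N"
  by (induction N) auto

lemma p_trans_series_parallel [simp]: "N \<in> series_parallel \<Longrightarrow> p_trans N \<in> series_parallel"
  by (induction rule: series_parallel.induct) auto

lemma freq_inverse_series_parallel [simp]: "N \<in> series_parallel \<Longrightarrow> freq_inverse N \<in> series_parallel"
  by (induction rule: series_parallel.induct) auto

lemma num_storage_p_trans [simp]: "num_storage (p_trans N) = num_storage N"
proof -
  have "num_inductors (Conductor G) = 0" "num_capacitors (Conductor G) = 0" for G
    by (simp_all add: Conductor_def)
  then show ?thesis by (induction N) (auto simp: num_storage_def)
qed

lemma val_p_trans: "N \<in> series_parallel \<Longrightarrow> 0 < s \<Longrightarrow> val (p_trans N) s = inverse (val N (1 / s))"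
  by (induction rule: series_parallel.induct) (auto simp: inverse_ennreal inverse_eq_divide)

lemma val_freq_inverse: "N \<in> series_parallel \<Longrightarrow> 0 < s \<Longrightarrow> val (freq_inverse N) s = val N (1 / s)"
  by (induction rule: series_parallel.induct) auto

lemma p_trans_eqv:
  "N \<in> series_parallel \<Longrightarrow> M \<in> series_parallel \<Longrightarrow> N \<simeq> M \<Longrightarrow> p_trans N \<simeq> p_trans M"
  by (simp add: eqv_def val_p_trans)

lemma freq_inverse_eqv:
  "N \<in> series_parallel \<Longrightarrow> M \<in> series_parallel \<Longrightarrow> N \<simeq> M \<Longrightarrow> freq_inverse N \<simeq> freq_inverse M"
  by (simp add: eqv_def val_freq_inverse)

section \<open>Impedance scaling and the exchange of resistors and conductors\<close>

primrec scale :: "real \<Rightarrow> network \<Rightarrow> network" where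
  "scale k (Resistor R) = Resistor (k * R)"
| "scale k Open_Circuit = Open_Circuit"
| "scale k (Inductor L) = Inductor (k * L)"
| "scale k (Capacitor C) = Capacitor (C / k)"
| "scale k (N \<oplus> N') = scale k N \<oplus> scale k N'"
| "scale k (N \<parallel> N') = scale k N \<parallel> scale k N'"

lemma scale_Conductor [simp]: "scale k (Conductor G) = (if k = 0 \<and> G \<noteq> 0 then Resistor 0 else Conductor (G / k))"
  by (simp add: Conductor_def)

lemma scale_series_parallel [simp]: "N \<in> series_parallel \<Longrightarrow> 0 < k \<Longrightarrow> scale k N \<in> series_parallel"
  by (induction rule: series_parallel.induct) auto

lemma val_scale:
  assumes "N \<in> series_parallel" "0 < k" "0 < s"
  shows "val (scale k N) s = ennreal k * val N s"
  using assms(1)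
proof (induction rule: series_parallel.induct)
  case (1 R)
  then show ?case using assms by (simp add: ennreal_mult)
next
  case 2
  then show ?case using assms by (simp add: ennreal_mult_top)
next
  case (3 L)
  then show ?case using assms by (simp add: mult.assoc flip: ennreal_mult)
next
  case (4 C)
  then show ?case using assms by (simp flip: ennreal_mult)
next
  case (5 N N')
  then show ?case by (simp add: distrib_left)
next
  case (6 N N')
  have 1: "inverse (ennreal k * e) = inverse (ennreal k) * inverse e" for e
    by (rule ennreal_inverse_mult') (use assms(2) in auto)
  have 2: "inverse (inverse (ennreal k) * e) = ennreal k * inverse e" for e
    using 1[of "inverse e"] by (metis inverse_inverse_ennreal)
  have "val (scale k (N \<parallel> N')) s =
      inverse (inverse (ennreal k) * inverse (val N s) + inverse (ennreal k) * inverse (val N' s))"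
    by (simp only: scale.simps val.simps 6 1)
  also have "\<dots> = ennreal k * val (N \<parallel> N') s"
    by (simp only: distrib_left[symmetric] 2 val.simps)
  finally show ?case .
qed

lemma scale_eqv:
  "N \<in> series_parallel \<Longrightarrow> M \<in> series_parallel \<Longrightarrow> 0 < k \<Longrightarrow> N \<simeq> M \<Longrightarrow> scale k N \<simeq> scale k M"
  by (simp add: eqv_def val_scale)

lemma ratio_scale: 
  assumes "ratio e x y" "0 < k" shows "ratio (ennreal k * e) (k * x) y"
  using assms by (auto simp: ratio_def ennreal_mult_top add_pos_nonneg add_nonneg_pos simp flip: ennreal_mult)

text \<open>For \<open>N\<close> of impedance \<open>z\<close> the left side is
  \<open>(R + z) / (D + G * z)\<close>, with the value \<open>R / D\<close> at \<open>z = 0\<close>.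
  Subtracting it leaves \<open>z / (D * (D + G * z))\<close>, whose inverse is
  \<open>G * D + D\<^sup>2 / z\<close>.\<close>

lemma Conductor_Resistor_exchange:
  assumes "N \<in> series_parallel" "0 \<le> R" "0 \<le> G" 
  defines "D \<equiv> 1 + G * R"
  shows "Conductor G \<parallel> (Resistor R \<oplus> N) \<simeq>
    Resistor (R / D) \<oplus> (Conductor (G * D) \<parallel> scale (1 / D\<^sup>2) N)"
proof (rule eqvI)
  fix s :: real assume s: "0 < s"
  obtain x y where xy: "ratio (val N s) x y" using ratio_exists by blast
  have D: "0 < D" unfolding D_def using assms by (simp add: add_pos_nonneg)
  have sc: "ratio (val (scale (1 / D\<^sup>2) N) s) (1 / D\<^sup>2 * x) y"
    using ratio_scale[OF xy, of "1 / D\<^sup>2"] assms(1) D s by (simp add: val_scale)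
  show "val (Conductor G \<parallel> (Resistor R \<oplus> N)) s =
    val (Resistor (R / D) \<oplus> (Conductor (G * D) \<parallel> scale (1 / D\<^sup>2) N)) s"
  proof (rule ratio_eqI)
    show "ratio (val (Conductor G \<parallel> (Resistor R \<oplus> N)) s) (R * y + x) (G * (R * y + x) + y)"
      by (intro ratio_rules xy assms)
    show "ratio (val (Resistor (R / D) \<oplus> (Conductor (G * D) \<parallel> scale (1 / D\<^sup>2) N)) s)
      (R / D * (G * D * (1 / D\<^sup>2 * x) + y) + 1 / D\<^sup>2 * x) (G * D * (1 / D\<^sup>2 * x) + y)"
      by (intro ratio_rules sc) (use assms D in auto)
    have "R / D * (G * D * (1 / D\<^sup>2 * x) + y) + 1 / D\<^sup>2 * x = (x * (1 + G * R) / D + R * y) / D"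
      using D by (simp add: field_simps power2_eq_square)
    also have "\<dots> = (R * y + x) / D"
      using D by (simp add: D_def[symmetric] add.commute)
    finally have "R / D * (G * D * (1 / D\<^sup>2 * x) + y) + 1 / D\<^sup>2 * x = (R * y + x) / D" .
    moreover have "G * D * (1 / D\<^sup>2 * x) + y = (G * x + D * y) / D"
      using D by (simp add: field_simps power2_eq_square)
    moreover have "G * x + D * y = G * (R * y + x) + y" by (simp add: D_def algebra_simps)
    ultimately show "(R * y + x) * (G * D * (1 / D\<^sup>2 * x) + y) =
      (R / D * (G * D * (1 / D\<^sup>2 * x) + y) + 1 / D\<^sup>2 * x) * (G * (R * y + x) + y)"
      by simp
  qed
qed


section \<open>Classes of networks up to equivalence\<close>

text \<open>Membership in \<open>series_parallel\<close> is built in because \<open>p_trans\<close>,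
  \<open>freq_inverse\<close> and \<open>scale\<close> are shown to respect \<open>\<simeq>\<close>
  for such networks.\<close>

definition eqv_closure :: "network set \<Rightarrow> network set" where
  "eqv_closure S = {N \<in> series_parallel. \<exists>M \<in> S. M \<in> series_parallel \<and> N \<simeq> M}"

lemma eqv_closureI: "M \<in> S \<Longrightarrow> N \<simeq> M \<Longrightarrow> N \<in> series_parallel \<Longrightarrow> M \<in> series_parallel \<Longrightarrow> N \<in> eqv_closure S"
  by (auto simp: eqv_closure_def)

lemma eqv_closureE:
  assumes "N \<in> eqv_closure S"
  obtains M where "M \<in> S" "N \<simeq> M" "N \<in> series_parallel" "M \<in> series_parallel"
  using assms by (auto simp: eqv_closure_def)

lemma eqv_closure_base: "N \<in> S \<Longrightarrow> N \<in> series_parallel \<Longrightarrow> N \<in> eqv_closure S"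
  by (blast intro: eqv_closureI eqv_refl)

lemma eqv_closure_subset: "eqv_closure S \<subseteq> series_parallel"
  by (auto simp: eqv_closure_def)

lemma eqv_closure_series_parallel: "N \<in> eqv_closure S \<Longrightarrow> N \<in> series_parallel"
  by (auto simp: eqv_closure_def)

lemma eqv_closure_eqv: "M \<in> eqv_closure S \<Longrightarrow> N \<simeq> M \<Longrightarrow> N \<in> series_parallel \<Longrightarrow> N \<in> eqv_closure S"
  unfolding eqv_closure_def using eqv_trans by blast

lemma eqv_closure_mono: "S \<subseteq> T \<Longrightarrow> eqv_closure S \<subseteq> eqv_closure T"
  by (auto simp: eqv_closure_def)

lemma eqv_closure_least: "S \<inter> series_parallel \<subseteq> eqv_closure T \<Longrightarrow> eqv_closure S \<subseteq> eqv_closure T"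
  by (meson IntI eqv_closureE eqv_closure_eqv subset_iff)

text \<open>The short circuit is the seed: series resistors produce every resistor from it, and
  \<open>p_trans\<close> the open circuit. Closure under parallel conductors follows by conjugating
  with \<open>p_trans\<close>.\<close>

definition admissible :: "network set \<Rightarrow> bool" where
  "admissible S \<longleftrightarrow> S = eqv_closure S \<and> Resistor 0 \<in> S \<and> (\<forall>N\<in>S. p_trans N \<in> S) \<and>
     (\<forall>R\<ge>0. \<forall>N\<in>S. Resistor R \<oplus> N \<in> S)"

lemma eqv_closure_idem [simp]: "eqv_closure (eqv_closure S) = eqv_closure S"
  by (meson eqv_closure_base eqv_closure_least eqv_closure_series_parallel inf_le1 subset_antisym subsetI)

lemma p_trans_eqv_closure:
  assumes "\<And>M. M \<in> S \<Longrightarrow> M \<in> series_parallel \<Longrightarrow> p_trans M \<in> eqv_closure T" "N \<in> eqv_closure S"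
  shows "p_trans N \<in> eqv_closure T"
  using assms by (meson eqv_closureE eqv_closure_eqv p_trans_eqv p_trans_series_parallel)

lemma freq_inverse_eqv_closure:
  assumes "\<And>M. M \<in> S \<Longrightarrow> M \<in> series_parallel \<Longrightarrow> freq_inverse M \<in> eqv_closure T" "N \<in> eqv_closure S"
  shows "freq_inverse N \<in> eqv_closure T"
  using assms by (meson eqv_closureE eqv_closure_eqv freq_inverse_eqv freq_inverse_series_parallel)

lemma scale_eqv_closure:
  assumes "\<And>M. M \<in> S \<Longrightarrow> M \<in> series_parallel \<Longrightarrow> scale k M \<in> eqv_closure T" "0 < k" "N \<in> eqv_closure S"
  shows "scale k N \<in> eqv_closure T"
  using assms by (meson eqv_closureE eqv_closure_eqv scale_eqv scale_series_parallel)

lemma series_eqv_closure: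
  assumes "\<And>N M. N \<in> S \<Longrightarrow> M \<in> T \<Longrightarrow> N \<in> series_parallel \<Longrightarrow> M \<in> series_parallel \<Longrightarrow> N \<oplus> M \<in> eqv_closure U"
    and "N \<in> eqv_closure S" "M \<in> eqv_closure T"
  shows "N \<oplus> M \<in> eqv_closure U"
  using assms by (meson eqv_closureE eqv_closure_eqv eqv_series series_parallel.intros(5))

lemma parallel_eqv_closure:
  assumes "\<And>N M. N \<in> S \<Longrightarrow> M \<in> T \<Longrightarrow> N \<in> series_parallel \<Longrightarrow> M \<in> series_parallel \<Longrightarrow> N \<parallel> M \<in> eqv_closure U"
    and "N \<in> eqv_closure S" "M \<in> eqv_closure T"
  shows "N \<parallel> M \<in> eqv_closure U"
  using assms by (meson eqv_closureE eqv_closure_eqv eqv_parallel series_parallel.intros(6))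

lemma Resistor_series_eqv_closure:
  assumes "\<And>M. M \<in> S \<Longrightarrow> M \<in> series_parallel \<Longrightarrow> Resistor R \<oplus> M \<in> eqv_closure T" "0 \<le> R" "N \<in> eqv_closure S"
  shows "Resistor R \<oplus> N \<in> eqv_closure T"
  by (rule series_eqv_closure[of "{Resistor R}" S]) (use assms in \<open>auto intro: eqv_closure_base\<close>)

lemma Conductor_parallel_eqv_closure:
  assumes "\<And>M. M \<in> S \<Longrightarrow> M \<in> series_parallel \<Longrightarrow> Conductor G \<parallel> M \<in> eqv_closure T" "0 \<le> G" "N \<in> eqv_closure S"
  shows "Conductor G \<parallel> N \<in> eqv_closure T"
  by (rule parallel_eqv_closure[of "{Conductor G}" S]) (use assms in \<open>auto intro: eqv_closure_base\<close>)

lemma admissible_closureI: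
  assumes "Resistor 0 \<in> S"
    and "\<And>M. M \<in> S \<Longrightarrow> M \<in> series_parallel \<Longrightarrow> p_trans M \<in> eqv_closure S"
    and "\<And>R M. 0 \<le> R \<Longrightarrow> M \<in> S \<Longrightarrow> M \<in> series_parallel \<Longrightarrow> Resistor R \<oplus> M \<in> eqv_closure S"
  shows "admissible (eqv_closure S)"
  unfolding admissible_def
  using assms by (auto intro: eqv_closure_base p_trans_eqv_closure Resistor_series_eqv_closure)

lemma admissible_eqv: "admissible S \<Longrightarrow> M \<in> S \<Longrightarrow> N \<simeq> M \<Longrightarrow> N \<in> series_parallel \<Longrightarrow> N \<in> S"
  unfolding admissible_def using eqv_closure_eqv by metis

lemma admissible_p_trans: "admissible S \<Longrightarrow> N \<in> S \<Longrightarrow> p_trans N \<in> S"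
  by (simp add: admissible_def)

lemma admissible_series_parallel: "admissible S \<Longrightarrow> N \<in> S \<Longrightarrow> N \<in> series_parallel"
  unfolding admissible_def using eqv_closure_series_parallel by metis

lemma admissible_Resistor_series: "admissible S \<Longrightarrow> N \<in> S \<Longrightarrow> 0 \<le> R \<Longrightarrow> Resistor R \<oplus> N \<in> S"
  by (simp add: admissible_def)

lemma admissible_Conductor_parallel:
  assumes "admissible S" "N \<in> S" "0 \<le> G" shows "Conductor G \<parallel> N \<in> S"
proof -
  have "p_trans (Resistor G \<oplus> p_trans N) \<in> S"
    using assms admissible_p_trans admissible_Resistor_series by blast
  then show ?thesis by simp
qed

definition resistive :: "network set" where
  "resistive = {Resistor R | R. 0 \<le> R} \<union> {Open_Circuit}"

lemma admissible_resistive: "admissible S \<Longrightarrow> resistive \<subseteq> S"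
proof -
  assume S: "admissible S"
  have "p_trans (Resistor 0) \<in> S"
    using S unfolding admissible_def by blast
  moreover have "Resistor R \<in> S" if "0 \<le> R" for R
    by (rule admissible_eqv[OF S admissible_Resistor_series[OF S, of "Resistor 0" R]])
       (use S that in \<open>auto simp: eqv_def admissible_def\<close>)
  ultimately show ?thesis by (auto simp: resistive_def Conductor_def)
qed

lemma admissible_resistive_series:
  assumes S: "admissible S" and N: "N \<in> resistive" and M: "M \<in> S"
  shows "N \<oplus> M \<in> S"
proof (cases "N = Open_Circuit")
  case True
  then show ?thesis
    using admissible_eqv[OF S, of Open_Circuit "N \<oplus> M"] admissible_resistive[OF S]
      admissible_series_parallel[OF S M]
    by (auto simp: eqv_def resistive_def)
next
  case False
  then show ?thesis using N admissible_Resistor_series[OF S M] by (auto simp: resistive_def)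
qed

lemma resistive_series_parallel: "resistive \<subseteq> series_parallel"
  by (auto simp: resistive_def)

lemma p_trans_resistive: "N \<in> resistive \<Longrightarrow> p_trans N \<in> resistive"
  by (auto simp: resistive_def Conductor_def split: if_split_asm)

lemma parallel_from_series:
  assumes "\<And>N M. N \<in> S \<Longrightarrow> M \<in> T \<Longrightarrow> N \<oplus> M \<in> U"
    and "\<And>N. N \<in> S \<Longrightarrow> p_trans N \<in> S" "\<And>N. N \<in> T \<Longrightarrow> p_trans N \<in> T" "\<And>N. N \<in> U \<Longrightarrow> p_trans N \<in> U"
    and "N \<in> S" "M \<in> T"
  shows "N \<parallel> M \<in> U"
proof -
  have "p_trans (p_trans N \<oplus> p_trans M) \<in> U" using assms by blast
  then show ?thesis by simp
qed

lemma series_from_parallel: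
  assumes "\<And>N M. N \<in> S \<Longrightarrow> M \<in> T \<Longrightarrow> N \<parallel> M \<in> U"
    and "\<And>N. N \<in> S \<Longrightarrow> p_trans N \<in> S" "\<And>N. N \<in> T \<Longrightarrow> p_trans N \<in> T" "\<And>N. N \<in> U \<Longrightarrow> p_trans N \<in> U"
    and "N \<in> S" "M \<in> T"
  shows "N \<oplus> M \<in> U"
proof -
  have "p_trans (p_trans N \<parallel> p_trans M) \<in> U" using assms by blast
  then show ?thesis by simp
qed

lemma admissible_resistive_parallel:
  assumes S: "admissible S" and "N \<in> resistive" "M \<in> S" shows "N \<parallel> M \<in> S"
  by (rule parallel_from_series[of resistive S S])
     (use assms in \<open>auto intro: admissible_resistive_series admissible_p_trans p_trans_resistive\<close>)


section \<open>Networks with one energy storage element\<close>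

text \<open>With inductors or capacitors for \<open>B\<close> this is \<open>N3\<close> or
  \<open>N2\<close> together with \<open>N1\<close> and the open circuit. The empty \<open>B\<close>
  gives the networks without storage elements.\<close>

definition one_storage :: "network set \<Rightarrow> network set" where
  "one_storage B = resistive \<union>
     {Resistor R \<oplus> (Conductor G \<parallel> X) | R G X. 0 \<le> R \<and> 0 \<le> G \<and> X \<in> B}"

lemma one_storage_closureI:
  "0 \<le> R \<Longrightarrow> 0 \<le> G \<Longrightarrow> X \<in> B \<Longrightarrow> X \<in> series_parallel \<Longrightarrow>
     Resistor R \<oplus> (Conductor G \<parallel> X) \<in> eqv_closure (one_storage B)"
  by (rule eqv_closure_base) (auto simp: one_storage_def)

text \<open>The critical point is \<open>p_trans\<close>: it puts the conductor outside and the
  resistor inside. The exchange restores the order at the cost of scaling the storage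
  element.\<close>

lemma admissible_one_storage:
  assumes p: "\<And>X. X \<in> B \<Longrightarrow> p_trans X \<in> B" and sc: "\<And>X k. X \<in> B \<Longrightarrow> 0 < k \<Longrightarrow> scale k X \<in> B"
  shows "admissible (eqv_closure (one_storage B))"
proof (rule admissible_closureI)
  show "Resistor 0 \<in> one_storage B" by (simp add: one_storage_def resistive_def)
next
  fix M assume M: "M \<in> one_storage B" "M \<in> series_parallel"
  show "p_trans M \<in> eqv_closure (one_storage B)"
  proof (cases "M \<in> resistive")
    case True
    then show ?thesis
      using p_trans_resistive[OF True] resistive_series_parallel
      by (intro eqv_closure_base) (auto simp: one_storage_def)
  next
    case False
    then obtain R G X where X: "M = Resistor R \<oplus> (Conductor G \<parallel> X)" "0 \<le> R" "0 \<le> G" "X \<in> B"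
      using M(1) by (auto simp: one_storage_def)
    define D where "D = 1 + R * G"
    have D: "0 < D" unfolding D_def using X by (simp add: add_pos_nonneg)
    have "p_trans M \<simeq> Resistor (G / D) \<oplus> (Conductor (R * D) \<parallel> scale (1 / D\<^sup>2) (p_trans X))"
      using Conductor_Resistor_exchange[of "p_trans X" G R] X M(2) by (simp add: D_def)
    moreover have "Resistor (G / D) \<oplus> (Conductor (R * D) \<parallel> scale (1 / D\<^sup>2) (p_trans X))
        \<in> eqv_closure (one_storage B)"
      by (rule one_storage_closureI) (use X M D p sc[OF p[OF X(4)], of "1 / D\<^sup>2"] in auto)
    ultimately show ?thesis
      using M(2) by (blast intro: eqv_closure_eqv p_trans_series_parallel)
  qed
next
  fix R :: real and M assume M: "0 \<le> R" "M \<in> one_storage B" "M \<in> series_parallel"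
  show "Resistor R \<oplus> M \<in> eqv_closure (one_storage B)"
  proof (cases "M \<in> resistive")
    case True
    then have "M = Open_Circuit \<or> (\<exists>R'\<ge>0. M = Resistor R')" by (auto simp: resistive_def)
    then have "\<exists>M'\<in>resistive. Resistor R \<oplus> M \<simeq> M'"
    proof
      assume "\<exists>R'\<ge>0. M = Resistor R'"
      then obtain R' where "0 \<le> R'" "M = Resistor R'" by blast
      with M(1) show ?thesis
        by (intro bexI[of _ "Resistor (R + R')"]) (auto simp: eqv_def resistive_def)
    qed (auto simp: eqv_def resistive_def)
    then obtain M' where "M' \<in> resistive" "Resistor R \<oplus> M \<simeq> M'" by blast
    then show ?thesis
      by (intro eqv_closureI[of M']) (use M resistive_series_parallel in \<open>auto simp: one_storage_def\<close>)
  next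
    case False
    then obtain R' G X where X: "M = Resistor R' \<oplus> (Conductor G \<parallel> X)" "0 \<le> R'" "0 \<le> G" "X \<in> B"
      using M(2) by (auto simp: one_storage_def)
    have "Resistor R \<oplus> M \<simeq> Resistor (R + R') \<oplus> (Conductor G \<parallel> X)"
      unfolding X(1) using M(1) X(2) by (rule Resistor_merge)
    moreover have "Resistor (R + R') \<oplus> (Conductor G \<parallel> X) \<in> eqv_closure (one_storage B)"
      by (rule one_storage_closureI) (use X M in auto)
    ultimately show ?thesis
      using M(1,3) by (blast intro: eqv_closure_eqv series_parallel.intros(1,5))
  qed
qed

definition inductors :: "network set" where "inductors = {Inductor L | L. 0 < L}"
definition capacitors :: "network set" where "capacitors = {Capacitor C | C. 0 < C}"

lemma p_trans_inductors: "X \<in> inductors \<Longrightarrow> p_trans X \<in> inductors"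
  and p_trans_capacitors: "X \<in> capacitors \<Longrightarrow> p_trans X \<in> capacitors"
  by (auto simp: inductors_def capacitors_def)

lemma scale_inductors: "X \<in> inductors \<Longrightarrow> 0 < k \<Longrightarrow> scale k X \<in> inductors"
  and scale_capacitors: "X \<in> capacitors \<Longrightarrow> 0 < k \<Longrightarrow> scale k X \<in> capacitors"
  by (auto simp: inductors_def capacitors_def)

abbreviation RL_networks :: "network set" where "RL_networks \<equiv> eqv_closure (one_storage inductors)"
abbreviation RC_networks :: "network set" where "RC_networks \<equiv> eqv_closure (one_storage capacitors)"

lemma admissible_RL: "admissible RL_networks"
  by (rule admissible_one_storage) (rule p_trans_inductors scale_inductors; assumption)+

lemma admissible_RC: "admissible RC_networks"
  by (rule admissible_one_storage) (rule p_trans_capacitors scale_capacitors; assumption)+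

lemma Inductor_RL: "0 < L \<Longrightarrow> Inductor L \<in> RL_networks"
  by (rule eqv_closureI[of "Resistor 0 \<oplus> (Conductor 0 \<parallel> Inductor L)"])
     (auto simp: one_storage_def inductors_def eqv_def simp del: Conductor_0)

lemma Capacitor_RC: "0 < C \<Longrightarrow> Capacitor C \<in> RC_networks"
  by (rule eqv_closureI[of "Resistor 0 \<oplus> (Conductor 0 \<parallel> Capacitor C)"])
     (auto simp: one_storage_def capacitors_def eqv_def simp del: Conductor_0)

lemma one_storage_cases:
  assumes "M \<in> one_storage B"
  obtains "M \<in> resistive"
  | R G X where "M = Resistor R \<oplus> (Conductor G \<parallel> X)" "0 \<le> R" "0 \<le> G" "X \<in> B"
  using assms by (auto simp: one_storage_def)

text \<open>A second canonical form, with the conductor outermost: take the first form of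
  \<open>p_trans N\<close> and transform it back. In a parallel connection this conductor can be
  handed over to the other network.\<close>

lemma p_trans_one_storage:
  assumes "admissible (eqv_closure (one_storage B))" "N \<in> eqv_closure (one_storage B)" "N \<notin> eqv_closure resistive"
  obtains R G X where "0 \<le> R" "0 \<le> G" "X \<in> B" "X \<in> series_parallel"
    "N \<simeq> Conductor G \<parallel> (Resistor R \<oplus> p_trans X)"
proof -
  have N: "N \<in> series_parallel" using assms(2) by (rule eqv_closure_series_parallel)
  have "p_trans N \<in> eqv_closure (one_storage B)"
    using admissible_p_trans[OF assms(1,2)] .
  then obtain M where M: "M \<in> one_storage B" "p_trans N \<simeq> M" "M \<in> series_parallel"
    by (rule eqv_closureE)
  have NM: "N \<simeq> p_trans M"
    using p_trans_eqv[OF _ M(3,2)] N by simp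
  from M(1) show ?thesis
  proof (cases rule: one_storage_cases)
    case 1
    then have "N \<in> eqv_closure resistive"
      using NM N M(3) by (intro eqv_closureI[of "p_trans M"]) (auto simp: p_trans_resistive)
    then show ?thesis using assms(3) by blast
  next
    case (2 R G X)
    then show ?thesis using NM M(3) by (intro that[of G R X]) auto
  qed
qed


section \<open>Networks with two inductors\<close>

definition RLL_networks :: "network set" where
  "RLL_networks = eqv_closure (one_storage inductors \<union> N5)"

lemma RL_subset_RLL: "RL_networks \<subseteq> RLL_networks"
  unfolding RLL_networks_def by (rule eqv_closure_mono) auto

lemma RLL_eqv: "M \<in> RLL_networks \<Longrightarrow> N \<simeq> M \<Longrightarrow> N \<in> series_parallel \<Longrightarrow> N \<in> RLL_networks"
  unfolding RLL_networks_def by (rule eqv_closure_eqv)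

lemma RLL_N5:
  "0 \<le> R1 \<Longrightarrow> 0 < L2 \<Longrightarrow> 0 < R2 \<Longrightarrow> 0 \<le> G3 \<Longrightarrow> 0 < L1 \<Longrightarrow>
    Resistor R1 \<oplus> (Inductor L2 \<parallel> (Resistor R2 \<oplus> (Conductor G3 \<parallel> Inductor L1))) \<in> RLL_networks"
  unfolding RLL_networks_def by (rule eqv_closure_base) (auto simp: N5_def)

lemma RLL_Resistor_series:
  assumes "N \<in> RLL_networks" "0 \<le> R" shows "Resistor R \<oplus> N \<in> RLL_networks"
  using assms(1) unfolding RLL_networks_def
proof (rule Resistor_series_eqv_closure[rotated 2])
  fix M assume M: "M \<in> one_storage inductors \<union> N5" "M \<in> series_parallel"
  show "Resistor R \<oplus> M \<in> eqv_closure (one_storage inductors \<union> N5)"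
  proof (cases "M \<in> N5")
    case True
    then obtain R1 L2 R2 G3 L1 where 
      M': "M = Resistor R1 \<oplus> (Inductor L2 \<parallel> (Resistor R2 \<oplus> (Conductor G3 \<parallel> Inductor L1)))"
      and pos: "0 \<le> R1" "0 < L2" "0 < R2" "0 \<le> G3" "0 < L1"
      by (auto simp: N5_def)
    have "Resistor R \<oplus> M \<in> RLL_networks"
      by (rule RLL_eqv[OF RLL_N5[of "R + R1" L2 R2 G3 L1]])
         (use pos assms(2) in \<open>auto simp: M' intro: Resistor_merge\<close>)
    then show ?thesis by (simp add: RLL_networks_def)
  next
    case False
    then have "Resistor R \<oplus> M \<in> RL_networks"
      using M assms(2) by (intro admissible_Resistor_series[OF admissible_RL] eqv_closure_base) auto
    then show ?thesis using RL_subset_RLL RLL_networks_def by blast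
  qed
qed (rule assms)

text \<open>The conductor travels inwards: it is exchanged with \<open>R1\<close>, slides past the
  parallel inductor \<open>L2\<close>, is exchanged with \<open>R2\<close> and merges with
  \<open>G3\<close>. Each exchange rescales whatever lies further inside.\<close>

lemma RLL_Conductor_parallel:
  assumes "N \<in> RLL_networks" "0 \<le> G" shows "Conductor G \<parallel> N \<in> RLL_networks"
  using assms(1) unfolding RLL_networks_def
proof (rule Conductor_parallel_eqv_closure[rotated 2])
  fix M assume M: "M \<in> one_storage inductors \<union> N5" "M \<in> series_parallel"
  show "Conductor G \<parallel> M \<in> eqv_closure (one_storage inductors \<union> N5)"
  proof (cases "M \<in> N5")
    case True
    then obtain R1 L2 R2 G3 L1 where 
      M': "M = Resistor R1 \<oplus> (Inductor L2 \<parallel> (Resistor R2 \<oplus> (Conductor G3 \<parallel> Inductor L1)))"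
      and pos: "0 \<le> R1" "0 < L2" "0 < R2" "0 \<le> G3" "0 < L1"
      by (auto simp: N5_def)
    define D where "D = 1 + G * R1"
    define k where "k = 1 / D\<^sup>2"
    have D: "0 < D" unfolding D_def using pos assms(2) by (simp add: add_pos_nonneg)
    then have k: "0 < k" by (simp add: k_def)
    let ?Q = "Conductor (G3 / k) \<parallel> Inductor (k * L1)"
    \<comment> \<open>The second exchange meets \<open>R2\<close> and the conductor after the first
      one has changed them to \<open>k * R2\<close> and \<open>G * D\<close>.\<close>
    define D' where "D' = 1 + (G * D) * (k * R2)"
    define k' where "k' = 1 / D'\<^sup>2"
    have D': "0 < D'" unfolding D'_def using pos assms(2) D k by (simp add: add_pos_nonneg)
    then have k': "0 < k'" by (simp add: k'_def)
    have "Conductor G \<parallel> M \<simeq> Resistor (R1 / D) \<oplus> (Conductor (G * D) \<parallel>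
      (Inductor (k * L2) \<parallel> (Resistor (k * R2) \<oplus> ?Q)))"
      using Conductor_Resistor_exchange[of "Inductor L2 \<parallel> (Resistor R2 \<oplus> (Conductor G3 \<parallel> Inductor L1))" R1 G]
        pos assms(2) k by (simp add: M' D_def[symmetric] k_def[symmetric])
    also have "\<dots> \<simeq> Resistor (R1 / D) \<oplus> (Inductor (k * L2) \<parallel>
      (Conductor (G * D) \<parallel> (Resistor (k * R2) \<oplus> ?Q)))"
      by (intro eqv_series eqv_refl parallel_left_commute)
    also have "\<dots> \<simeq> Resistor (R1 / D) \<oplus> (Inductor (k * L2) \<parallel>
      (Resistor (k * R2 / D') \<oplus> (Conductor (G * D * D') \<parallel> (Conductor (G3 / k / k') \<parallel> Inductor (k' * (k * L1))))))"
      using Conductor_Resistor_exchange[of ?Q "k * R2" "G * D"] pos assms(2) k k' D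
      by (intro eqv_series eqv_parallel eqv_refl) (simp add: D'_def[symmetric] k'_def[symmetric])
    also have "\<dots> \<simeq> Resistor (R1 / D) \<oplus> (Inductor (k * L2) \<parallel>
      (Resistor (k * R2 / D') \<oplus> (Conductor (G * D * D' + G3 / k / k') \<parallel> Inductor (k' * (k * L1)))))"
      by (intro eqv_series eqv_parallel eqv_refl Conductor_merge) (use pos assms(2) D D' k k' in auto)
    finally have "Conductor G \<parallel> M \<in> RLL_networks"
      by (rule RLL_eqv[OF RLL_N5, rotated 5]) (use pos assms(2) D D' k k' M(2) in auto)
    then show ?thesis by (simp add: RLL_networks_def)
  next
    case False
    then have "Conductor G \<parallel> M \<in> RL_networks"
      using M assms(2) by (intro admissible_Conductor_parallel[OF admissible_RL] eqv_closure_base) auto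
    then show ?thesis using RL_subset_RLL RLL_networks_def by blast
  qed
qed (rule assms)

text \<open>A sum of two first-order terms is rewritten as a ladder. The admittance has the pole
  \<open>1 / (S * s)\<close> at 0, which is split off as the parallel inductor \<open>S\<close>; the
  value at 0 of the remaining impedance is then split off as a resistor, and a conductor in parallel
  with an inductor is left.\<close>

lemma RLL_Foster:
  assumes pos: "0 \<le> G1" "0 < L1" "0 \<le> G2" "0 < L2"
  shows "(Conductor G1 \<parallel> Inductor L1) \<oplus> (Conductor G2 \<parallel> Inductor L2) \<in> RLL_networks" (is "?N \<in> _")
proof -
  define a b S where "a = G1 * L1" and "b = G2 * L2" and "S = L1 + L2"
  have ab: "0 \<le> a" "0 \<le> b" and S: "0 < S" using pos by (auto simp: a_def b_def S_def)
  have N: "ratio (val ?N s) ((S + (L1 * b + L2 * a) * s) * s) ((1 + a * s) * (1 + b * s))"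
    if "0 < s" for s
  proof -
    have "ratio (val ?N s) (L1 * s * (G2 * (L2 * s) + 1) + L2 * s * (G1 * (L1 * s) + 1))
      ((G1 * (L1 * s) + 1) * (G2 * (L2 * s) + 1))"
      unfolding val.simps(5)
      by (intro ratio_add ratio_rules add_pos_pos[OF add_nonneg_pos add_nonneg_pos]) (use that pos in auto)
    then show ?thesis by (simp add: S_def a_def b_def algebra_simps)
  qed
  show ?thesis
  proof (cases "a = b")
    case True
    \<comment> \<open>The two poles coincide, so the sum has degree one and a single inductor
      suffices.\<close>
    have "?N \<simeq> Resistor 0 \<oplus> (Conductor (a / S) \<parallel> Inductor S)"
    proof (rule eqvI, rule ratio_eqI[OF N])
      fix s :: real assume s: "0 < s"
      show "ratio (val (Resistor 0 \<oplus> (Conductor (a / S) \<parallel> Inductor S)) s)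
        (0 * (a / S * (S * s) + 1) + S * s) (a / S * (S * s) + 1)"
        by (intro ratio_rules) (use s S ab in auto)
      show "(S + (L1 * b + L2 * a) * s) * s * (a / S * (S * s) + 1)
        = (0 * (a / S * (S * s) + 1) + S * s) * ((1 + a * s) * (1 + b * s))"
      proof -
        have 1: "a / S * (S * s) + 1 = 1 + b * s" using S by (simp add: True)
        have 2: "S + (L1 * b + L2 * a) * s = S * (1 + b * s)" by (simp add: True S_def algebra_simps)
        show ?thesis unfolding 1 2 by (simp add: True)
      qed
    qed
    then have "?N \<in> RL_networks"
      by (rule eqv_closure_eqv[rotated]) (use pos S ab in \<open>auto simp: inductors_def intro!: one_storage_closureI\<close>)
    then show ?thesis using RL_subset_RLL by blast
  next
    case False
    \<comment> \<open>Splitting off the inductor \<open>S\<close> leaves the impedance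
      \<open>S * M / T\<close>, with \<open>M\<close> and \<open>T\<close> as defined below. Its
      value at 0 is \<open>S\<^sup>2 / E\<close>; \<open>E\<close> is positive because
      \<open>a\<close> and \<open>b\<close> are not both zero.\<close>
    define E where "E = L1 * a + L2 * b"
    have E: "0 < E"
    proof (cases "a = 0")
      case True
      then show ?thesis using False ab pos by (simp add: E_def)
    next
      case False
      then show ?thesis using ab pos unfolding E_def by (intro add_pos_nonneg) auto
    qed
    \<comment> \<open>After the resistor \<open>S\<^sup>2 / E\<close> the remainder is
      \<open>S * H * s / (E * T)\<close>. Since \<open>H\<close> measures the distance of the two
      poles, it is positive exactly because they differ.\<close>
    define H where "H = L1 * L2 * (a - b)\<^sup>2"
    have H: "0 < H" using False pos by (simp add: H_def)
    have HE: "S\<^sup>2 * (a * b) + H = E * (L1 * b + L2 * a)"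
      by (simp add: H_def E_def S_def power2_eq_square algebra_simps)
    let ?L = "S * H / E\<^sup>2" and ?G = "E * (a * b) / H"
    have "?N \<simeq> Resistor 0 \<oplus> (Inductor S \<parallel> (Resistor (S\<^sup>2 / E) \<oplus> (Conductor ?G \<parallel> Inductor ?L)))"
    proof (rule eqvI, rule ratio_eqI[OF N])
      fix s :: real assume s: "0 < s"
      define M T where "M = S + (L1 * b + L2 * a) * s" and "T = E + S * (a * b) * s"
      have M: "0 < M" unfolding M_def using S s ab pos by (auto intro!: add_pos_nonneg)
      have T: "0 < T" unfolding T_def using S s ab E by (auto intro!: add_pos_nonneg)
      have "ratio (val (Conductor ?G \<parallel> Inductor ?L) s) (?L * s) (?G * (?L * s) + 1)"
        by (intro ratio_rules) (use s S ab E H in auto)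
      moreover have "?G * (?L * s) + 1 = T / E"
        using E H by (simp add: T_def power2_eq_square add_divide_distrib)
      ultimately have "ratio (val (Conductor ?G \<parallel> Inductor ?L) s) (?L * s) (T / E)"
        by simp
      then have "ratio (val (Conductor ?G \<parallel> Inductor ?L) s) (S * H * s) (E * T)"
      proof (rule ratio_cong)
        show "?L * s * (E * T) = S * H * s * (T / E)" using E by (simp add: power2_eq_square)
      qed (use s S T E H in \<open>simp_all add: add_pos_pos\<close>)
      then have "ratio (val (Resistor (S\<^sup>2 / E) \<oplus> (Conductor ?G \<parallel> Inductor ?L)) s)
        (S\<^sup>2 / E * (E * T) + S * H * s) (E * T)"
        by (intro ratio_rules) (use S E in auto)
      moreover have "S\<^sup>2 / E * (E * T) + S * H * s = S\<^sup>2 * E + S * s * (S\<^sup>2 * (a * b) + H)"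
        using E by (simp add: T_def algebra_simps)
      moreover have "\<dots> = E * (S * M)" 
        unfolding HE by (simp add: M_def algebra_simps power2_eq_square)
      ultimately have "ratio (val (Resistor (S\<^sup>2 / E) \<oplus> (Conductor ?G \<parallel> Inductor ?L)) s) (E * (S * M)) (E * T)"
        by simp
      then have "ratio (val (Resistor (S\<^sup>2 / E) \<oplus> (Conductor ?G \<parallel> Inductor ?L)) s) (S * M) T"
        by (rule ratio_cong) (use S M T in \<open>auto intro!: add_pos_pos\<close>)
      then show "ratio (val (Resistor 0 \<oplus> (Inductor S \<parallel> (Resistor (S\<^sup>2 / E) \<oplus> (Conductor ?G \<parallel> Inductor ?L)))) s)
        (0 * (S * M + S * s * T) + S * s * (S * M)) (S * M + S * s * T)"
        by (intro ratio_rules) (use S s in auto)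
      have "S * (a + b) = L1 * b + L2 * a + E" by (simp add: S_def E_def algebra_simps)
      then have "M + s * T = S + S * (a + b) * s + S * (a * b) * s\<^sup>2"
        by (simp add: M_def T_def algebra_simps power2_eq_square)
      then have "M + s * T = S * ((1 + a * s) * (1 + b * s))"
        by (simp add: algebra_simps power2_eq_square)
      then have "S * M + S * s * T = S * (S * ((1 + a * s) * (1 + b * s)))"
        by (metis distrib_left mult.assoc)
      then show "(S + (L1 * b + L2 * a) * s) * s * (S * M + S * s * T) =
        (0 * (S * M + S * s * T) + S * s * (S * M)) * ((1 + a * s) * (1 + b * s))"
        unfolding M_def[symmetric] by simp
    qed
    then show ?thesis
      by (rule RLL_eqv[OF RLL_N5, rotated 5]) (use pos ab S E H in auto)
  qed
qed

lemma RL_series_RL: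
  assumes "N \<in> RL_networks" "M \<in> RL_networks" shows "N \<oplus> M \<in> RLL_networks"
proof -
  have *: "N \<oplus> M \<in> RLL_networks" if NM: "N \<in> one_storage inductors" "M \<in> one_storage inductors"
    "N \<in> series_parallel" "M \<in> series_parallel" for N M
  proof -
    consider "N \<in> resistive" | "M \<in> resistive" | "N \<notin> resistive" "M \<notin> resistive" by blast
    then show ?thesis
    proof cases
      case 1
      then have "N \<oplus> M \<in> RL_networks"
        using NM by (intro admissible_resistive_series[OF admissible_RL]) (auto intro: eqv_closure_base)
      then show ?thesis using RL_subset_RLL by blast
    next
      case 2
      then have "M \<oplus> N \<in> RL_networks"
        using NM by (intro admissible_resistive_series[OF admissible_RL]) (auto intro: eqv_closure_base)
      then have "N \<oplus> M \<in> RL_networks"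
        using NM by (elim eqv_closure_eqv) (auto simp: eqv_def add_ac)
      then show ?thesis using RL_subset_RLL by blast
    next
      case 3
      then obtain R G L R' G' L' where
        N: "N = Resistor R \<oplus> (Conductor G \<parallel> Inductor L)" "0 \<le> R" "0 \<le> G" "0 < L" and
        M: "M = Resistor R' \<oplus> (Conductor G' \<parallel> Inductor L')" "0 \<le> R'" "0 \<le> G'" "0 < L'"
        using NM by (auto simp: one_storage_def inductors_def)
      have "Resistor R \<oplus> (Resistor R' \<oplus> ((Conductor G \<parallel> Inductor L) \<oplus> (Conductor G' \<parallel> Inductor L'))) \<in> RLL_networks"
        using N M by (intro RLL_Resistor_series RLL_Foster)
      then show ?thesis
        by (rule RLL_eqv) (use N M in \<open>auto simp: eqv_def add_ac\<close>)
    qed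
  qed
  show ?thesis
    unfolding RLL_networks_def
    by (rule series_eqv_closure[OF _ assms]) (use * in \<open>simp add: RLL_networks_def\<close>)
qed

lemma admissible_RLL: "admissible RLL_networks"
  unfolding RLL_networks_def
proof (rule admissible_closureI)
  show "Resistor 0 \<in> one_storage inductors \<union> N5" by (simp add: one_storage_def resistive_def)
next
  fix M assume M: "M \<in> one_storage inductors \<union> N5" "M \<in> series_parallel"
  show "p_trans M \<in> eqv_closure (one_storage inductors \<union> N5)"
  proof (cases "M \<in> N5")
    case True
    then obtain R1 L2 R2 G3 L1 where 
      M': "M = Resistor R1 \<oplus> (Inductor L2 \<parallel> (Resistor R2 \<oplus> (Conductor G3 \<parallel> Inductor L1)))"
      and pos: "0 \<le> R1" "0 < L2" "0 < R2" "0 \<le> G3" "0 < L1"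
      by (auto simp: N5_def)
    \<comment> \<open>Here \<open>p_trans M\<close> is a conductor in parallel with a series
      connection of an inductor and an RL network, which the Foster form covers.\<close>
    have "p_trans M \<in> RLL_networks"
      unfolding M' p_trans_simps p_trans_Conductor
      by (intro RLL_Conductor_parallel RL_series_RL admissible_Conductor_parallel[OF admissible_RL]
            admissible_Resistor_series[OF admissible_RL] Inductor_RL) (use pos in auto)
    then show ?thesis by (simp add: RLL_networks_def)
  next
    case False
    then have "p_trans M \<in> RL_networks"
      using M by (intro admissible_p_trans[OF admissible_RL] eqv_closure_base) auto
    then show ?thesis using RL_subset_RLL RLL_networks_def by blast
  qed
next
  fix R :: real and M assume "0 \<le> R" "M \<in> one_storage inductors \<union> N5" "M \<in> series_parallel"
  then show "Resistor R \<oplus> M \<in> eqv_closure (one_storage inductors \<union> N5)"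
    using RLL_Resistor_series[of M R] by (auto simp: RLL_networks_def intro: eqv_closure_base)
qed

lemma RL_parallel_RL: "N \<in> RL_networks \<Longrightarrow> M \<in> RL_networks \<Longrightarrow> N \<parallel> M \<in> RLL_networks"
  by (rule parallel_from_series[of RL_networks RL_networks])
     (auto intro: RL_series_RL admissible_p_trans admissible_RL admissible_RLL)

lemma scale_one_storage:
  assumes N: "N \<in> eqv_closure (one_storage B)" and k: "0 < k" and B: "\<And>X. X \<in> B \<Longrightarrow> scale k X \<in> B"
  shows "scale k N \<in> eqv_closure (one_storage B)"
proof (rule scale_eqv_closure[OF _ k N])
  fix M assume M: "M \<in> one_storage B" "M \<in> series_parallel"
  from M(1) show "scale k M \<in> eqv_closure (one_storage B)"
  proof (cases rule: one_storage_cases)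
    case 1
    then have "scale k M \<in> resistive" using k by (auto simp: resistive_def)
    then show ?thesis
      using M(2) k by (intro eqv_closure_base) (auto simp: one_storage_def)
  next
    case (2 R G X)
    have "0 \<le> k * R" "0 \<le> G / k" using 2 k by auto
    then show ?thesis unfolding 2(1) scale.simps
      using 2 k M(2) B[OF 2(4)] by (auto intro!: one_storage_closureI)
  qed
qed

lemma scale_RL: "N \<in> RL_networks \<Longrightarrow> 0 < k \<Longrightarrow> scale k N \<in> RL_networks"
  by (erule scale_one_storage) (auto intro: scale_inductors)

lemma scale_RC: "N \<in> RC_networks \<Longrightarrow> 0 < k \<Longrightarrow> scale k N \<in> RC_networks"
  by (erule scale_one_storage) (auto intro: scale_capacitors)

lemma scale_RLL:
  assumes "N \<in> RLL_networks" "0 < k" shows "scale k N \<in> RLL_networks"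
  unfolding RLL_networks_def
proof (rule scale_eqv_closure[OF _ assms(2) assms(1)[unfolded RLL_networks_def]])
  fix M assume M: "M \<in> one_storage inductors \<union> N5" "M \<in> series_parallel"
  show "scale k M \<in> eqv_closure (one_storage inductors \<union> N5)"
    unfolding RLL_networks_def[symmetric]
  proof (cases "M \<in> N5")
    case True
    then show "scale k M \<in> RLL_networks"
      using assms(2) by (auto simp: N5_def intro!: RLL_N5)
  next
    case False
    then show "scale k M \<in> RLL_networks"
      using M scale_RL[OF eqv_closure_base assms(2)] RL_subset_RLL by blast
  qed
qed

section \<open>Networks with one inductor and one capacitor\<close>

definition RLC_networks :: "network set" where
  "RLC_networks = eqv_closure
     (one_storage inductors \<union> one_storage capacitors \<union> N6 \<union> N7 \<union> N8 \<union> N9)"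

lemma N6I: "0 \<le> R1 \<Longrightarrow> 0 < L1 \<Longrightarrow> 0 \<le> R2 \<Longrightarrow> 0 \<le> G3 \<Longrightarrow> 0 < C1 \<Longrightarrow>
    Resistor R1 \<oplus> (Inductor L1 \<parallel> (Resistor R2 \<oplus> (Conductor G3 \<parallel> Capacitor C1))) \<in> N6"
  unfolding N6_def by blast

lemma N7I: "0 \<le> R1 \<Longrightarrow> 0 < C1 \<Longrightarrow> 0 \<le> R2 \<Longrightarrow> 0 \<le> G3 \<Longrightarrow> 0 < L1 \<Longrightarrow>
    Resistor R1 \<oplus> (Capacitor C1 \<parallel> (Resistor R2 \<oplus> (Conductor G3 \<parallel> Inductor L1))) \<in> N7"
  unfolding N7_def by blast

lemma N8I: "0 \<le> G1 \<Longrightarrow> 0 < C1 \<Longrightarrow> 0 \<le> G2 \<Longrightarrow> 0 \<le> R3 \<Longrightarrow> 0 < L1 \<Longrightarrow>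
    Conductor G1 \<parallel> (Capacitor C1 \<oplus> (Conductor G2 \<parallel> (Resistor R3 \<oplus> Inductor L1))) \<in> N8"
  unfolding N8_def by blast

lemma N9I: "0 \<le> G1 \<Longrightarrow> 0 < L1 \<Longrightarrow> 0 \<le> G2 \<Longrightarrow> 0 \<le> R3 \<Longrightarrow> 0 < C1 \<Longrightarrow>
    Conductor G1 \<parallel> (Inductor L1 \<oplus> (Conductor G2 \<parallel> (Resistor R3 \<oplus> Capacitor C1))) \<in> N9"
  unfolding N9_def by blast

lemma RL_subset_RLC: "RL_networks \<subseteq> RLC_networks"
  unfolding RLC_networks_def by (rule eqv_closure_mono) auto

lemma RC_subset_RLC: "RC_networks \<subseteq> RLC_networks"
  unfolding RLC_networks_def by (rule eqv_closure_mono) auto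

lemma RLC_eqv: "M \<in> RLC_networks \<Longrightarrow> N \<simeq> M \<Longrightarrow> N \<in> series_parallel \<Longrightarrow> N \<in> RLC_networks"
  unfolding RLC_networks_def by (rule eqv_closure_eqv)

lemma N6_to_N9_subset_RLC: "N6 \<union> N7 \<union> N8 \<union> N9 \<subseteq> RLC_networks"
proof
  fix N assume "N \<in> N6 \<union> N7 \<union> N8 \<union> N9"
  then have "N \<in> series_parallel" by (auto simp: N6_def N7_def N8_def N9_def)
  with \<open>N \<in> N6 \<union> N7 \<union> N8 \<union> N9\<close> show "N \<in> RLC_networks"
    unfolding RLC_networks_def by (intro eqv_closure_base) auto
qed

lemma RLC_cases:
  assumes "M \<in> one_storage inductors \<union> one_storage capacitors \<union> N6 \<union> N7 \<union> N8 \<union> N9" "M \<in> series_parallel"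
  obtains "M \<in> RL_networks" | "M \<in> RC_networks" | "M \<in> N6" | "M \<in> N7" | "M \<in> N8" | "M \<in> N9"
  using assms by (auto intro: eqv_closure_base)

lemma freq_inverse_one_storage:
  assumes "N \<in> eqv_closure (one_storage B)" and B: "\<And>X. X \<in> B \<Longrightarrow> freq_inverse X \<in> B'"
  shows "freq_inverse N \<in> eqv_closure (one_storage B')"
proof (rule freq_inverse_eqv_closure[OF _ assms(1)])
  fix M assume M: "M \<in> one_storage B" "M \<in> series_parallel"
  from M(1) have "freq_inverse M \<in> one_storage B'"
  proof (cases rule: one_storage_cases)
    case 1
    then show ?thesis by (auto simp: one_storage_def resistive_def)
  next
    case (2 R G X)
    then show ?thesis using B[OF 2(4)] by (auto simp: one_storage_def)
  qed
  then show "freq_inverse M \<in> eqv_closure (one_storage B')"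
    using M(2) by (intro eqv_closure_base) auto
qed

lemma freq_inverse_RL: "N \<in> RL_networks \<Longrightarrow> freq_inverse N \<in> RC_networks"
  by (erule freq_inverse_one_storage) (auto simp: inductors_def capacitors_def)

lemma freq_inverse_RC: "N \<in> RC_networks \<Longrightarrow> freq_inverse N \<in> RL_networks"
  by (erule freq_inverse_one_storage) (auto simp: inductors_def capacitors_def)

text \<open>Frequency inversion swaps \<open>N6\<close> with \<open>N7\<close> and \<open>N8\<close>
  with \<open>N9\<close>, while \<open>p_trans\<close> swaps \<open>N6\<close> with
  \<open>N9\<close> and \<open>N7\<close> with \<open>N8\<close>. The four classes form one orbit,
  so a realization in \<open>N6\<close> serves for all of them.\<close>

lemma freq_inverse_RLC: "N \<in> RLC_networks \<Longrightarrow> freq_inverse N \<in> RLC_networks"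
proof -
  assume N: "N \<in> RLC_networks"
  show ?thesis
    unfolding RLC_networks_def
  proof (rule freq_inverse_eqv_closure[OF _ N[unfolded RLC_networks_def]])
    fix M assume "M \<in> one_storage inductors \<union> one_storage capacitors \<union> N6 \<union> N7 \<union> N8 \<union> N9" "M \<in> series_parallel"
    then have "freq_inverse M \<in> RLC_networks"
    proof (cases rule: RLC_cases)
      case 1 then show ?thesis using freq_inverse_RL RC_subset_RLC by blast
    next
      case 2 then show ?thesis using freq_inverse_RC RL_subset_RLC by blast
    next
      case 3
      then have "freq_inverse M \<in> N7" by (auto simp: N6_def intro!: N7I)
      then show ?thesis using N6_to_N9_subset_RLC by blast
    next
      case 4
      then have "freq_inverse M \<in> N6" by (auto simp: N7_def intro!: N6I)
      then show ?thesis using N6_to_N9_subset_RLC by blast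
    next
      case 5
      then have "freq_inverse M \<in> N9" by (auto simp: N8_def intro!: N9I)
      then show ?thesis using N6_to_N9_subset_RLC by blast
    next
      case 6
      then have "freq_inverse M \<in> N8" by (auto simp: N9_def intro!: N8I)
      then show ?thesis using N6_to_N9_subset_RLC by blast
    qed
    then show "freq_inverse M \<in> eqv_closure
      (one_storage inductors \<union> one_storage capacitors \<union> N6 \<union> N7 \<union> N8 \<union> N9)"
      by (simp add: RLC_networks_def)
  qed
qed

lemma p_trans_RLC: "N \<in> RLC_networks \<Longrightarrow> p_trans N \<in> RLC_networks"
proof -
  assume N: "N \<in> RLC_networks"
  show ?thesis
    unfolding RLC_networks_def
  proof (rule p_trans_eqv_closure[OF _ N[unfolded RLC_networks_def]])
    fix M assume "M \<in> one_storage inductors \<union> one_storage capacitors \<union> N6 \<union> N7 \<union> N8 \<union> N9" "M \<in> series_parallel"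
    then have "p_trans M \<in> RLC_networks"
    proof (cases rule: RLC_cases)
      case 1 then show ?thesis using admissible_p_trans[OF admissible_RL] RL_subset_RLC by blast
    next
      case 2 then show ?thesis using admissible_p_trans[OF admissible_RC] RC_subset_RLC by blast
    next
      case 3
      then have "p_trans M \<in> N9" by (auto simp: N6_def intro!: N9I)
      then show ?thesis using N6_to_N9_subset_RLC by blast
    next
      case 4
      then have "p_trans M \<in> N8" by (auto simp: N7_def intro!: N8I)
      then show ?thesis using N6_to_N9_subset_RLC by blast
    next
      case 5
      then have "p_trans M \<in> N7" by (auto simp: N8_def intro!: N7I)
      then show ?thesis using N6_to_N9_subset_RLC by blast
    next
      case 6
      then have "p_trans M \<in> N6" by (auto simp: N9_def intro!: N6I)
      then show ?thesis using N6_to_N9_subset_RLC by blast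
    qed
    then show "p_trans M \<in> eqv_closure
      (one_storage inductors \<union> one_storage capacitors \<union> N6 \<union> N7 \<union> N8 \<union> N9)"
      by (simp add: RLC_networks_def)
  qed
qed

section \<open>Realization of bilinear and biquadratic impedances\<close>

lemma ratio_mult: "ratio e x y \<Longrightarrow> 0 < c \<Longrightarrow> ratio e (c * x) (c * y)"
proof (rule ratio_cong)
  assume "ratio e x y" "0 < c"
  then have "0 < c * (x + y)" by (auto dest: ratioD)
  then show "0 < c * x + c * y" by (simp add: distrib_left)
qed (auto dest: ratioD)

text \<open>For \<open>d > 0\<close> the value \<open>b / d\<close> at 0 is split off as a resistor.
  With the determinant \<open>H = a * d - b * c\<close> the remainder is
  \<open>H * s / (d * (c * s + d))\<close>, whose inverse
  \<open>d\<^sup>2 / (H * s) + d * c / H\<close> is an inductor in parallel with a conductor. A zero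
  determinant or \<open>d = 0\<close> leaves a resistor or an open circuit.\<close>

lemma RL_realization:
  assumes N: "N \<in> series_parallel" and pos: "0 \<le> a" "0 \<le> b" "0 \<le> c" "0 \<le> d"
    and r: "\<And>s. 0 < s \<Longrightarrow> ratio (val N s) (a * s + b) (c * s + d)" and le: "b * c \<le> a * d"
  shows "N \<in> RL_networks"
proof -
  have res: "N \<in> RL_networks" if "M \<in> resistive" "\<And>s. 0 < s \<Longrightarrow> val N s = val M s" for M
    using admissible_eqv[OF admissible_RL, of M N] admissible_resistive[OF admissible_RL] that N
    by (auto simp: eqv_def)
  consider "d = 0" "c = 0" | "d = 0" "0 < c" | "0 < d" "a * d = b * c" | "0 < d" "b * c < a * d"
    using pos(3,4) le by (metis less_eq_real_def)
  then show ?thesis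
  proof cases
    case 1
    have "val N s = val Open_Circuit s" if "0 < s" for s
      using r[OF that] 1 by (simp add: ratio_def)
    then show ?thesis by (intro res[of Open_Circuit]) (simp_all add: resistive_def)
  next
    case 2
    then have "b = 0" using le pos by (metis mult_zero_right mult_pos_pos not_less order_le_less)
    show ?thesis
    proof (rule res[of "Resistor (a / c)"])
      fix s :: real assume s: "0 < s"
      show "val N s = val (Resistor (a / c)) s"
        by (rule ratio_eqI[OF r[OF s] ratio_Resistor]) (use 2 pos \<open>b = 0\<close> in simp_all)
    qed (use pos in \<open>auto simp: resistive_def\<close>)
  next
    case 3
    show ?thesis
    proof (rule res[of "Resistor (b / d)"])
      fix s :: real assume s: "0 < s"
      show "val N s = val (Resistor (b / d)) s"
      proof (rule ratio_eqI[OF r[OF s] ratio_Resistor])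
        have "(a * s + b) * d = (a * d) * s + b * d" by (simp add: algebra_simps)
        also have "\<dots> = b * (c * s + d)" unfolding 3(2) by (simp add: algebra_simps)
        finally show "(a * s + b) * 1 = b / d * (c * s + d)" using 3(1) by (simp add: nonzero_eq_divide_eq)
      qed (use 3 pos in auto)
    qed (use pos in \<open>auto simp: resistive_def\<close>)
  next
    case 4
    define H where "H = a * d - b * c"
    have H: "0 < H" using 4 by (simp add: H_def)
    let ?M = "Resistor (b / d) \<oplus> (Conductor (d * c / H) \<parallel> Inductor (H / d\<^sup>2))"
    have "N \<simeq> ?M"
    proof (rule eqvI, rule ratio_eqI[OF r])
      fix s :: real assume s: "0 < s"
      have "ratio (val (Conductor (d * c / H) \<parallel> Inductor (H / d\<^sup>2)) s) 
          (H / d\<^sup>2 * s) (d * c / H * (H / d\<^sup>2 * s) + 1)"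
        by (intro ratio_rules) (use s pos 4 H in auto)
      moreover have "d * c / H * (H / d\<^sup>2 * s) + 1 = (c * s + d) / d"
      proof -
        have "d * c / H * (H / d\<^sup>2 * s) = c * s / d" using H 4(1) by (simp add: power2_eq_square)
        then show ?thesis using 4(1) by (simp add: add_divide_distrib)
      qed
      ultimately have "ratio (val (Conductor (d * c / H) \<parallel> Inductor (H / d\<^sup>2)) s) 
          (H / d\<^sup>2 * s) ((c * s + d) / d)" by simp
      from ratio_mult[OF this, of "d\<^sup>2"] 4(1)
      have "ratio (val (Conductor (d * c / H) \<parallel> Inductor (H / d\<^sup>2)) s)
          (d\<^sup>2 * (H / d\<^sup>2 * s)) (d\<^sup>2 * ((c * s + d) / d))" by simp
      moreover have "d\<^sup>2 * (H / d\<^sup>2 * s) = H * s" "d\<^sup>2 * ((c * s + d) / d) = d * (c * s + d)"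
        using 4(1) by (simp_all add: power2_eq_square)
      ultimately have "ratio (val (Conductor (d * c / H) \<parallel> Inductor (H / d\<^sup>2)) s) (H * s) (d * (c * s + d))"
        by simp
      then show "ratio (val ?M s) (b / d * (d * (c * s + d)) + H * s) (d * (c * s + d))"
        by (intro ratio_rules) (use pos in auto)
      have "b / d * (d * (c * s + d)) + H * s = d * (a * s + b)"
      proof -
        have "b / d * (d * (c * s + d)) = b * (c * s + d)" using 4 by simp
        then show ?thesis by (simp add: H_def algebra_simps)
      qed
      then show "(a * s + b) * (d * (c * s + d)) = (b / d * (d * (c * s + d)) + H * s) * (c * s + d)"
        by simp
    qed
    then show ?thesis
      by (rule eqv_closure_eqv[OF one_storage_closureI, rotated 4])
         (use pos 4 H N in \<open>auto simp: inductors_def\<close>)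
  qed
qed

text \<open>Replacing \<open>s\<close> by \<open>1 / s\<close> changes the sign of the determinant,
  so the remaining sign gives an RC network.\<close>

lemma bilinear_realization:
  assumes N: "N \<in> series_parallel" and pos: "0 \<le> a" "0 \<le> b" "0 \<le> c" "0 \<le> d"
    and r: "\<And>s. 0 < s \<Longrightarrow> ratio (val N s) (a * s + b) (c * s + d)"
  shows "N \<in> RLC_networks"
proof (cases "b * c \<le> a * d")
  case True
  then show ?thesis using RL_realization[OF assms] RL_subset_RLC by blast
next
  case False
  have "freq_inverse N \<in> RL_networks"
  proof (rule RL_realization[of _ b a d c])
    fix s :: real assume s: "0 < s"
    show "ratio (val (freq_inverse N) s) (b * s + a) (d * s + c)"
    proof -
      have "s * (x * (1 / s) + y) = y * s + x" for x y using s by (simp add: distrib_left)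
      then show ?thesis using ratio_mult[OF r[of "1 / s"] s] N s by (simp only: val_freq_inverse) simp
    qed
  qed (use N pos False in \<open>auto simp: mult.commute\<close>)
  then show ?thesis using freq_inverse_RL[of "freq_inverse N"] RC_subset_RLC by auto
qed

definition biquadratic :: "network \<Rightarrow> real \<Rightarrow> real \<Rightarrow> real \<Rightarrow> real \<Rightarrow> real \<Rightarrow> real \<Rightarrow> bool" where
  "biquadratic N A B C D E F \<longleftrightarrow> N \<in> series_parallel \<and>
     0 \<le> A \<and> 0 \<le> B \<and> 0 \<le> C \<and> 0 \<le> D \<and> 0 \<le> E \<and> 0 \<le> F \<and>
     (\<forall>s>0. ratio (val N s) (A * s\<^sup>2 + B * s + C) (D * s\<^sup>2 + E * s + F))"

lemma biquadratic_freq_inverse: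
  assumes "biquadratic N A B C D E F" shows "biquadratic (freq_inverse N) C B A F E D"
proof -
  have "ratio (val (freq_inverse N) s) (C * s\<^sup>2 + B * s + A) (F * s\<^sup>2 + E * s + D)" if s: "0 < s" for s
  proof -
    have "ratio (val N (1 / s)) (s\<^sup>2 * (A * (1 / s)\<^sup>2 + B * (1 / s) + C)) (s\<^sup>2 * (D * (1 / s)\<^sup>2 + E * (1 / s) + F))"
    proof (rule ratio_mult)
      have "0 < 1 / s" using s by simp
      then show "ratio (val N (1 / s)) (A * (1 / s)\<^sup>2 + B * (1 / s) + C) (D * (1 / s)\<^sup>2 + E * (1 / s) + F)"
        using assms unfolding biquadratic_def by blast
    qed (use s in simp)
    moreover have "s\<^sup>2 * (a * (1 / s)\<^sup>2 + b * (1 / s) + c) = c * s\<^sup>2 + b * s + a" for a b c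
      using s by (simp add: distrib_left power2_eq_square)
    ultimately show ?thesis
      using assms s by (simp only: val_freq_inverse biquadratic_def)
  qed
  then show ?thesis using assms by (simp add: biquadratic_def)
qed

lemma biquadratic_p_trans:
  assumes "biquadratic N A B C D E F" shows "biquadratic (p_trans N) F E D C B A"
proof -
  have "ratio (val (p_trans N) s) (F * s\<^sup>2 + E * s + D) (C * s\<^sup>2 + B * s + A)" if s: "0 < s" for s
    using biquadratic_freq_inverse[OF assms] assms s ratio_inverse
    by (auto simp: biquadratic_def val_p_trans val_freq_inverse)
  then show ?thesis using assms by (simp add: biquadratic_def)
qed

text \<open>
  Write \<open>q = A F - C D\<close>, \<open>p = A E - B D\<close>, \<open>r = B F - C E\<close>. The impedance has the resultant
  \<open>q\<^sup>2 - p r\<close>, and the conditions say that its real part on the imaginary axis is smallest at \<open>0\<close>.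
  One removes this minimum as the resistor \<open>C / F\<close>, and then the pole of the admittance at \<open>0\<close>
  as the inductor \<open>r / F\<^sup>2\<close>. What remains has degree one, and it is of the resistor-capacitor type
  because the resultant is nonnegative.
\<close>

lemma biquadratic_N6:
  assumes N: "biquadratic N A B C D E F" and q: "0 \<le> A * F - C * D"
    and min0: "F * (A * F - C * D) \<le> E * (B * F - C * E)"
    and res: "(A * E - B * D) * (B * F - C * E) \<le> (A * F - C * D)\<^sup>2"
  shows "N \<in> RLC_networks"
proof -
  have sp: "N \<in> series_parallel" and pos: "0 \<le> A" "0 \<le> B" "0 \<le> C" "0 \<le> D" "0 \<le> E" "0 \<le> F"
    and rN: "\<And>s. 0 < s \<Longrightarrow> ratio (val N s) (A * s\<^sup>2 + B * s + C) (D * s\<^sup>2 + E * s + F)"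
    using N by (auto simp: biquadratic_def)
  define p q r where pqr: "p = A * E - B * D" "q = A * F - C * D" "r = B * F - C * E"
  have q0: "0 \<le> q" using q by (simp add: pqr)
  show ?thesis
  proof (cases "F = 0")
    case True
    then have "C * D \<le> 0" using q by simp
    then have CD: "C * D = 0" using pos by (metis antisym mult_nonneg_nonneg)
    have "E * (C * E) \<le> 0" using True min0 by simp
    then have CE: "C * E = 0" using pos by (smt (verit) mult_eq_0_iff mult_nonneg_nonneg)
    \<comment> \<open>The resistor \<open>C / F\<close> does not exist here. The hypotheses leave
      two cases: a common factor \<open>s\<close> of numerator and denominator, or a zero
      denominator.\<close>
    show ?thesis
    proof (cases "C = 0")
      case C: True
      show ?thesis
      proof (rule bilinear_realization[OF sp pos(1,2,4,5)])
        fix s :: real assume s: "0 < s"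
        show "ratio (val N s) (A * s + B) (D * s + E)"
        proof -
          have "1 / s * (A * s\<^sup>2 + B * s + C) = A * s + B" "1 / s * (D * s\<^sup>2 + E * s + F) = D * s + E"
            using s C True by (simp_all add: distrib_left power2_eq_square)
          then show ?thesis using ratio_mult[OF rN[OF s], of "1 / s"] s by simp
        qed
      qed
    next
      case False
      then have "D = 0" "E = 0" using CD CE by auto
      have "N \<simeq> Open_Circuit"
      proof (rule eqvI)
        fix s :: real assume "0 < s"
        show "val N s = val Open_Circuit s"
          using rN[OF \<open>0 < s\<close>] \<open>D = 0\<close> \<open>E = 0\<close> True by (simp add: ratio_def)
      qed
      moreover have "Open_Circuit \<in> RLC_networks"
        using admissible_resistive[OF admissible_RL] RL_subset_RLC by (auto simp: resistive_def)
      ultimately show ?thesis using RLC_eqv sp by blast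
    qed
  next
    case False
    then have F: "0 < F" using pos by simp
    \<comment> \<open>The hypothesis \<open>min0\<close> says that \<open>w\<close> is nonnegative;
      \<open>w\<close> is the coefficient in the admittance that survives the removal of the pole at
      0.\<close>
    define w where "w = E * r - F * q"
    have w: "0 \<le> w" using min0 by (simp add: w_def pqr)
    \<comment> \<open>The relation between the 2 x 2 minors that comes from expanding a 3 x 3
      determinant with the row \<open>D, E, F\<close> repeated.\<close>
    have plucker: "D * r + F * p = E * q" by (simp add: pqr algebra_simps)
    have r0: "0 \<le> r"
    proof (cases "E = 0")
      case True
      then show ?thesis using pos by (simp add: pqr)
    next
      case False
      have "0 \<le> E * r" using w F q0 unfolding w_def by (smt (verit) mult_nonneg_nonneg)
      then show ?thesis using False pos by (simp add: zero_le_mult_iff)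
    qed
    show ?thesis
    proof (cases "r = 0")
      case True
      have "F * q \<le> 0" using w True by (simp add: w_def)
      then have "q = 0" using F q0 by (simp add: mult_le_0_iff)
      then have eq: "A * F = C * D" "B * F = C * E" using True by (auto simp: pqr)
      have "N \<simeq> Resistor (C / F)"
      proof (rule eqvI, rule ratio_eqI[OF rN ratio_Resistor])
        fix s :: real assume "0 < s"
        have "F * (A * s\<^sup>2 + B * s + C) = (A * F) * s\<^sup>2 + (B * F) * s + C * F" by (simp add: algebra_simps)
        also have "\<dots> = C * (D * s\<^sup>2 + E * s + F)" unfolding eq by (simp add: algebra_simps)
        finally show "(A * s\<^sup>2 + B * s + C) * 1 = C / F * (D * s\<^sup>2 + E * s + F)"
          using F by (simp add: field_simps)
      qed (use pos in auto)
      moreover have "Resistor (C / F) \<in> resistive" using pos by (auto simp: resistive_def)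
      then have "Resistor (C / F) \<in> RLC_networks"
        using admissible_resistive[OF admissible_RL] RL_subset_RLC by blast
      ultimately show ?thesis using RLC_eqv sp by blast
    next
      case False
      then have r: "0 < r" using r0 by simp
      \<comment> \<open>Subtracting \<open>C / F\<close> leaves
        \<open>s * (q * s + r) / (F * y)\<close> with \<open>y\<close> the denominator. Subtracting
        the pole \<open>F\<^sup>2 / (r * s)\<close> from its inverse leaves
        \<open>F * (D * r * s + w) / (r * (q * s + r))\<close>, the admittance demanded of
        \<open>X\<close>.\<close>
      have reduce: "N \<simeq> Resistor (C / F) \<oplus> (Inductor (r / F\<^sup>2) \<parallel> X)"
        if X: "\<And>s. 0 < s \<Longrightarrow> ratio (val X s) (r * (q * s + r)) (F * (D * r * s + w))" for X
      proof (rule eqvI, rule ratio_eqI[OF rN])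
        fix s :: real assume s: "0 < s"
        let ?y = "D * s\<^sup>2 + E * s + F"
        have "ratio (val (Inductor (r / F\<^sup>2) \<parallel> X) s) (r / F\<^sup>2 * s * (r * (q * s + r)))
          (r * (q * s + r) + r / F\<^sup>2 * s * (F * (D * r * s + w)))"
          by (intro ratio_rules X s) (use r F in auto)
        moreover have "r * (q * s + r) + r / F\<^sup>2 * s * (F * (D * r * s + w)) = r\<^sup>2 / F * ?y"
        proof -
          have "F * (q * s + r) + s * (D * r * s + w) = r * ?y"
            by (simp add: w_def algebra_simps power2_eq_square)
          moreover have "r * (q * s + r) + r / F\<^sup>2 * s * (F * (D * r * s + w))
              = r / F * (F * (q * s + r) + s * (D * r * s + w))"
            using F by (simp add: distrib_left power2_eq_square)
          ultimately show ?thesis by (simp add: power2_eq_square)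
        qed
        ultimately have *: "ratio (val (Inductor (r / F\<^sup>2) \<parallel> X) s) (r / F\<^sup>2 * s * (r * (q * s + r))) (r\<^sup>2 / F * ?y)"
          by simp
        have "ratio (val (Inductor (r / F\<^sup>2) \<parallel> X) s) (F\<^sup>2 / r\<^sup>2 * (r / F\<^sup>2 * s * (r * (q * s + r)))) (F\<^sup>2 / r\<^sup>2 * (r\<^sup>2 / F * ?y))"
          by (rule ratio_mult[OF *]) (use r F in auto)
        moreover have "F\<^sup>2 / r\<^sup>2 * (r / F\<^sup>2 * s * (r * (q * s + r))) = s * (q * s + r)"
          using r F by (simp add: power2_eq_square)
        moreover have "F\<^sup>2 / r\<^sup>2 * (r\<^sup>2 / F * ?y) = F * ?y"
          using r F by (simp add: power2_eq_square)
        ultimately have "ratio (val (Inductor (r / F\<^sup>2) \<parallel> X) s) (s * (q * s + r)) (F * ?y)"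
          by simp
        then show "ratio (val (Resistor (C / F) \<oplus> (Inductor (r / F\<^sup>2) \<parallel> X)) s)
          (C / F * (F * ?y) + s * (q * s + r)) (F * ?y)"
          by (intro ratio_rules) (use pos in auto)
        have "C / F * (F * ?y) = C * ?y" using F by simp
        moreover have "C * ?y + s * (q * s + r) = F * (A * s\<^sup>2 + B * s + C)"
          by (simp add: pqr algebra_simps power2_eq_square)
        ultimately have "C / F * (F * ?y) + s * (q * s + r) = F * (A * s\<^sup>2 + B * s + C)" by simp
        then show "(A * s\<^sup>2 + B * s + C) * (F * ?y) = (C / F * (F * ?y) + s * (q * s + r)) * ?y"
          by simp
      qed
      have reduce_resistive: "N \<in> RLC_networks"
        if "X \<in> resistive" "\<And>s. 0 < s \<Longrightarrow> ratio (val X s) (r * (q * s + r)) (F * (D * r * s + w))" for X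
      proof -
        have "X \<parallel> Inductor (r / F\<^sup>2) \<in> RL_networks"
          by (intro admissible_resistive_parallel[OF admissible_RL that(1)] Inductor_RL) (use r F in auto)
        then have "Resistor (C / F) \<oplus> (X \<parallel> Inductor (r / F\<^sup>2)) \<in> RL_networks"
          by (intro admissible_Resistor_series[OF admissible_RL]) (use pos in auto)
        moreover have "N \<simeq> Resistor (C / F) \<oplus> (X \<parallel> Inductor (r / F\<^sup>2))"
          using reduce[OF that(2)] by (simp add: eqv_def add.commute)
        ultimately show ?thesis using RL_subset_RLC RLC_eqv sp by blast
      qed
      \<comment> \<open>The bilinear impedance of \<open>X\<close> has the determinant
        \<open>- (r * F * H)\<close>. Since \<open>H\<close> is \<open>F\<close> times the resultant
        of the original impedance, its sign makes \<open>X\<close> of RC type.\<close>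
      define H where "H = D * r\<^sup>2 - q * w"
      have "H = F * (q\<^sup>2 - p * r)"
      proof -
        have "H = r * (D * r - E * q) + F * q\<^sup>2" by (simp add: H_def w_def algebra_simps power2_eq_square)
        also have "D * r - E * q = - F * p" using plucker by simp
        finally show ?thesis by (simp add: algebra_simps)
      qed
      then have H0: "0 \<le> H" using res F by (simp add: pqr)
      \<comment> \<open>The first case is the generic one. In the others the impedance of
        \<open>X\<close> is constant: \<open>q / (F * D)\<close>, infinite, or
        \<open>r\<^sup>2 / (F * w)\<close>, so that only the inductor remains as a storage
        element.\<close>
      consider "0 < H" | "H = 0" "0 < D" | "D = 0" "w = 0" | "D = 0" "0 < w" "q = 0"
      proof (cases "H = 0 \<and> D = 0 \<and> w \<noteq> 0")
        case True
        then have "D = 0" "D * r\<^sup>2 - q * w = 0" by (auto simp: H_def)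
        then have "q * w = 0" by (metis diff_0 mult_zero_left neg_equal_0_iff_equal)
        then show ?thesis using that(4) w True by auto
      next
        case False
        then show ?thesis using that(1,2,3) H0 pos(4) by fastforce
      qed
      then show ?thesis
      proof cases
        case 1
        have "0 \<le> q * w" using q0 w by simp
        then have "D \<noteq> 0" using 1 by (auto simp: H_def)
        then have D: "0 < D" using pos by simp
        \<comment> \<open>The value of \<open>X\<close> at infinity is \<open>q / (F * D)\<close>.
          What remains has the admittance \<open>F * D * w / H + F * D\<^sup>2 * r / H * s\<close>,
          a conductor in parallel with a capacitor.\<close>
        let ?Q = "Conductor (F * D * w / H) \<parallel> Capacitor (F * D\<^sup>2 * r / H)"
        have "N \<simeq> Resistor (C / F) \<oplus> (Inductor (r / F\<^sup>2) \<parallel> (Resistor (q / (F * D)) \<oplus> ?Q))"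
        proof (rule reduce)
          fix s :: real assume s: "0 < s"
          have *: "ratio (val ?Q s) 1 (F * D * w / H * 1 + F * D\<^sup>2 * r / H * s)"
            by (intro ratio_rules s) (use F D r w 1 in auto)
          have "ratio (val ?Q s) H (F * D * (D * r * s + w))"
          proof -
            have "H * (F * D * w / H * 1 + F * D\<^sup>2 * r / H * s) = F * D * (D * r * s + w)"
              using 1 by (simp add: distrib_left power2_eq_square mult_ac)
            then show ?thesis using ratio_mult[OF * 1] by simp
          qed
          then have **: "ratio (val (Resistor (q / (F * D)) \<oplus> ?Q) s) 
            (q / (F * D) * (F * D * (D * r * s + w)) + H) (F * D * (D * r * s + w))"
            by (intro ratio_rules) (use F D q0 in auto)
          have "q / (F * D) * (F * D * (D * r * s + w)) + H = D * (r * (q * s + r))"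
            using F D by (simp add: H_def algebra_simps power2_eq_square)
          with ** have "ratio (val (Resistor (q / (F * D)) \<oplus> ?Q) s) (D * (r * (q * s + r))) (F * D * (D * r * s + w))"
            by simp
          from ratio_mult[OF this, of "1 / D"] D
          show "ratio (val (Resistor (q / (F * D)) \<oplus> ?Q) s) (r * (q * s + r)) (F * (D * r * s + w))"
            by simp
        qed
        moreover have "Resistor (C / F) \<oplus> (Inductor (r / F\<^sup>2) \<parallel> (Resistor (q / (F * D)) \<oplus> ?Q)) \<in> N6"
          unfolding N6_def
          by (intro CollectI exI conjI, rule refl) (use F D q0 r w 1 pos in auto)
        ultimately show ?thesis using N6_to_N9_subset_RLC RLC_eqv sp by blast
      next
        case 2
        have qw: "q * w = D * r\<^sup>2" using 2 by (simp add: H_def)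
        then have "0 < q * w" using 2 r by simp
        then have qw_pos: "0 < q" "0 < w" using q0 w by (auto simp: zero_less_mult_iff)
        show ?thesis
        proof (rule reduce_resistive[of "Resistor (q / (F * D))"])
          fix s :: real assume s: "0 < s"
          show "ratio (val (Resistor (q / (F * D))) s) (r * (q * s + r)) (F * (D * r * s + w))"
          proof (rule ratio_cong[OF ratio_Resistor])
            have "q * (D * r * s + w) = D * (r * (q * s + r))"
              using qw by (simp add: algebra_simps power2_eq_square)
            then show "q / (F * D) * (F * (D * r * s + w)) = r * (q * s + r) * 1"
              using F 2 by (simp add: field_simps)
          qed (use F 2 qw_pos r s in \<open>simp_all add: add_pos_pos\<close>)
        qed (use F 2 q0 in \<open>auto simp: resistive_def\<close>)
      next
        case 3
        show ?thesis
        proof (rule reduce_resistive[of Open_Circuit])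
          fix s :: real assume "0 < s"
          then have "0 < r * (q * s + r)" using r q0 by (intro mult_pos_pos add_nonneg_pos) auto
          then show "ratio (val Open_Circuit s) (r * (q * s + r)) (F * (D * r * s + w))"
            using 3 by (simp add: ratio_def)
        qed (simp add: resistive_def)
      next
        case 4
        show ?thesis
        proof (rule reduce_resistive[of "Resistor (r\<^sup>2 / (F * w))"])
          fix s :: real assume s: "0 < s"
          show "ratio (val (Resistor (r\<^sup>2 / (F * w))) s) (r * (q * s + r)) (F * (D * r * s + w))"
            by (rule ratio_cong[OF ratio_Resistor]) (use 4 F r in \<open>auto simp: power2_eq_square intro!: add_pos_pos\<close>)
        qed (use F 4 r in \<open>auto simp: resistive_def\<close>)
      qed
    qed
  qed
qed

text \<open>The alternatives in \<open>regular\<close> are the conditions of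
  \<open>biquadratic_N6\<close> for \<open>N\<close>, for its p-transform, for its frequency inverse
  and for the composition of both. They place the minimum of the real part of the impedance at 0, of
  the admittance at infinity, of the impedance at infinity and of the admittance at 0. The resultant
  condition is invariant under all of these.\<close>

lemma RLC_biquadratic:
  assumes N: "biquadratic N A B C D E F"
    and res: "(A * E - B * D) * (B * F - C * E) \<le> (A * F - C * D)\<^sup>2"
    and regular: "C * D \<le> A * F \<and> F * (A * F - C * D) \<le> E * (B * F - C * E) \<or>
      C * D \<le> A * F \<and> A * (A * F - C * D) \<le> B * (A * E - B * D) \<or>
      A * F \<le> C * D \<and> E * (A * E - B * D) \<le> D * (A * F - C * D) \<or>
      A * F \<le> C * D \<and> B * (B * F - C * E) \<le> C * (A * F - C * D)"
  shows "N \<in> RLC_networks"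
  using regular
proof (elim disjE conjE)
  assume "C * D \<le> A * F" "F * (A * F - C * D) \<le> E * (B * F - C * E)"
  then show ?thesis using biquadratic_N6[OF N _ _ res] by simp
next
  assume "C * D \<le> A * F" "A * (A * F - C * D) \<le> B * (A * E - B * D)"
  then have "p_trans N \<in> RLC_networks"
    using res by (intro biquadratic_N6[OF biquadratic_p_trans[OF N]]) (simp_all add: mult_ac)
  then show ?thesis using p_trans_RLC[of "p_trans N"] by simp
next
  assume "A * F \<le> C * D" "E * (A * E - B * D) \<le> D * (A * F - C * D)"
  then have "freq_inverse N \<in> RLC_networks"
    using res
    by (intro biquadratic_N6[OF biquadratic_freq_inverse[OF N]]) (simp_all add: algebra_simps power2_eq_square)
  then show ?thesis using freq_inverse_RLC[of "freq_inverse N"] by simp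
next
  assume "A * F \<le> C * D" "B * (B * F - C * E) \<le> C * (A * F - C * D)"
  then have "p_trans (freq_inverse N) \<in> RLC_networks"
    using res
    by (intro biquadratic_N6[OF biquadratic_p_trans[OF biquadratic_freq_inverse[OF N]]])
       (simp_all add: algebra_simps power2_eq_square)
  then show ?thesis
    using freq_inverse_RLC[of "freq_inverse N"] p_trans_RLC[of "p_trans (freq_inverse N)"] by simp
qed

lemma ratio_subst: "ratio e x y \<Longrightarrow> x = x' \<Longrightarrow> y = y' \<Longrightarrow> ratio e x' y'"
  by simp

text \<open>The one nontrivial case of a series resistor: \<open>N6\<close> and \<open>N7\<close>
  begin with a resistor that absorbs it, and \<open>N9\<close> is the frequency inverse of
  \<open>N8\<close>.\<close>

lemma Resistor_series_N8:
  assumes "N \<in> N8" "0 \<le> R" shows "Resistor R \<oplus> N \<in> RLC_networks"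
proof -
  obtain G1 C1 G2 R3 L1 where
    N: "N = Conductor G1 \<parallel> (Capacitor C1 \<oplus> (Conductor G2 \<parallel> (Resistor R3 \<oplus> Inductor L1)))" and
    pos: "0 \<le> G1" "0 < C1" "0 \<le> G2" "0 \<le> R3" "0 < L1"
    using assms(1) by (auto simp: N8_def)
  define h A B where "h = 1 + G2 * R3" and "A = L1 * C1" and "B = R3 * C1 + G2 * L1"
  have h: "0 < h" unfolding h_def using pos by (simp add: add_pos_nonneg)
  have AB: "0 < A" "0 \<le> B" using pos by (auto simp: A_def B_def)
  define D E F where "D = (G1 + G2) * A" and "E = h * C1 + G1 * B" and "F = G1 * h"
  have DEF: "0 \<le> D" "0 \<le> E" "0 \<le> F" using pos AB h by (auto simp: D_def E_def F_def)
  have biq: "biquadratic (Resistor R \<oplus> N) (A + R * D) (B + R * E) (h + R * F) D E F"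
    unfolding biquadratic_def
  proof (intro conjI allI impI)
    fix s :: real assume s: "0 < s"
    show "ratio (val (Resistor R \<oplus> N) s)
      ((A + R * D) * s\<^sup>2 + (B + R * E) * s + (h + R * F)) (D * s\<^sup>2 + E * s + F)"
      unfolding N
      by (rule ratio_subst, (rule ratio_rules s assms(2) pos)+)
         (simp_all add: A_def B_def D_def E_def F_def h_def algebra_simps power2_eq_square)
  qed (use pos assms(2) AB DEF h in \<open>auto simp: N\<close>)
  \<comment> \<open>The three minors do not depend on \<open>R\<close>, which only adds a multiple
    of the denominator to the numerator.\<close>
  have q: "(A + R * D) * F - (h + R * F) * D = - (h * G2 * A)"
    by (simp add: D_def F_def algebra_simps)
  have p: "(A + R * D) * E - (B + R * E) * D = A * (h * C1 - G2 * B)"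
    by (simp add: D_def E_def algebra_simps)
  have r: "(B + R * E) * F - (h + R * F) * E = - (h\<^sup>2 * C1)"
    by (simp add: E_def F_def algebra_simps power2_eq_square)
  have GL: "G2 * L1 \<le> B" using pos by (simp add: B_def)
  have hC: "h * C1 - G2 * B = C1 - G2\<^sup>2 * L1"
    by (simp add: h_def B_def algebra_simps power2_eq_square)
  show ?thesis
  proof (rule RLC_biquadratic[OF biq])
    have "(h * G2 * A)\<^sup>2 + A * (C1 - G2\<^sup>2 * L1) * (h\<^sup>2 * C1) = A * h\<^sup>2 * C1\<^sup>2"
      by (simp add: A_def algebra_simps power2_eq_square)
    moreover have "0 \<le> A * h\<^sup>2 * C1\<^sup>2" using AB by simp
    ultimately show "((A + R * D) * E - (B + R * E) * D) * ((B + R * E) * F - (h + R * F) * E)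
      \<le> ((A + R * D) * F - (h + R * F) * D)\<^sup>2"
      unfolding p q r hC by simp
    \<comment> \<open>The fourth alternative will hold: the capacitor is open at frequency 0, where
      the admittance of \<open>N\<close> drops to \<open>G1\<close>. The inequality required for it
      is affine in \<open>R\<close>; \<open>bound\<close> is its constant part, and the estimate
      after it is the coefficient of \<open>R\<close>.\<close>
    have le: "(A + R * D) * F \<le> (h + R * F) * D"
      using q h AB pos by (smt (verit) mult_nonneg_nonneg)
    have "h * G2 * A = (G2 * L1) * (h * C1)" by (simp add: A_def)
    also have "\<dots> \<le> B * (h * C1)" using GL h pos by (intro mult_right_mono) auto
    finally have bound: "h * (h * G2 * A) \<le> B * (h\<^sup>2 * C1)"
      using h by (simp add: power2_eq_square mult_ac)
    moreover have "F * (h * G2 * A) \<le> E * (h\<^sup>2 * C1)"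
    proof -
      have "F * (h * G2 * A) = G1 * (h * (h * G2 * A))" by (simp add: F_def)
      also have "\<dots> \<le> G1 * (B * (h\<^sup>2 * C1))"
        by (rule mult_left_mono[OF bound pos(1)])
      also have "\<dots> \<le> E * (h\<^sup>2 * C1)"
        using h pos by (simp add: E_def distrib_right)
      finally show ?thesis .
    qed
    then have "R * (F * (h * G2 * A)) \<le> R * (E * (h\<^sup>2 * C1))"
      using assms(2) by (rule mult_left_mono)
    ultimately have "(h + R * F) * (h * G2 * A) \<le> (B + R * E) * (h\<^sup>2 * C1)"
      by (simp add: distrib_right mult.assoc)
    then have "(B + R * E) * ((B + R * E) * F - (h + R * F) * E)
      \<le> (h + R * F) * ((A + R * D) * F - (h + R * F) * D)"
      unfolding q r by simp
    with le show "(h + R * F) * D \<le> (A + R * D) * F \<and>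
        F * ((A + R * D) * F - (h + R * F) * D) \<le> E * ((B + R * E) * F - (h + R * F) * E) \<or>
      (h + R * F) * D \<le> (A + R * D) * F \<and>
        (A + R * D) * ((A + R * D) * F - (h + R * F) * D) \<le> (B + R * E) * ((A + R * D) * E - (B + R * E) * D) \<or>
      (A + R * D) * F \<le> (h + R * F) * D \<and>
        E * ((A + R * D) * E - (B + R * E) * D) \<le> D * ((A + R * D) * F - (h + R * F) * D) \<or>
      (A + R * D) * F \<le> (h + R * F) * D \<and>
        (B + R * E) * ((B + R * E) * F - (h + R * F) * E) \<le> (h + R * F) * ((A + R * D) * F - (h + R * F) * D)"
      by blast
  qed
qed

lemma admissible_RLC: "admissible RLC_networks"
  unfolding RLC_networks_def
proof (rule admissible_closureI, unfold RLC_networks_def[symmetric])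
  show "Resistor 0 \<in> one_storage inductors \<union> one_storage capacitors \<union> N6 \<union> N7 \<union> N8 \<union> N9"
    by (simp add: one_storage_def resistive_def)
next
  fix M assume "M \<in> one_storage inductors \<union> one_storage capacitors \<union> N6 \<union> N7 \<union> N8 \<union> N9" "M \<in> series_parallel"
  then have "M \<in> RLC_networks" unfolding RLC_networks_def by (intro eqv_closure_base)
  then show "p_trans M \<in> RLC_networks" by (rule p_trans_RLC)
next
  fix R :: real and M 
  assume R: "0 \<le> R" and M: "M \<in> one_storage inductors \<union> one_storage capacitors \<union> N6 \<union> N7 \<union> N8 \<union> N9" "M \<in> series_parallel"
  show "Resistor R \<oplus> M \<in> RLC_networks"
    using M
  proof (cases rule: RLC_cases)
    case 1
    then show ?thesis using admissible_Resistor_series[OF admissible_RL _ R] RL_subset_RLC by blast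
  next
    case 2
    then show ?thesis using admissible_Resistor_series[OF admissible_RC _ R] RC_subset_RLC by blast
  next
    case 3
    then obtain R1 X where X: "M = Resistor R1 \<oplus> X" "0 \<le> R1" "\<And>R. 0 \<le> R \<Longrightarrow> Resistor R \<oplus> X \<in> N6"
      unfolding N6_def by blast
    then have "Resistor (R + R1) \<oplus> X \<in> RLC_networks" using R N6_to_N9_subset_RLC by auto
    moreover have "Resistor R \<oplus> M \<simeq> Resistor (R + R1) \<oplus> X" unfolding X(1) by (rule Resistor_merge[OF R X(2)])
    ultimately show ?thesis using RLC_eqv R M(2) by auto
  next
    case 4
    then obtain R1 X where X: "M = Resistor R1 \<oplus> X" "0 \<le> R1" "\<And>R. 0 \<le> R \<Longrightarrow> Resistor R \<oplus> X \<in> N7"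
      unfolding N7_def by blast
    then have "Resistor (R + R1) \<oplus> X \<in> RLC_networks" using R N6_to_N9_subset_RLC by auto
    moreover have "Resistor R \<oplus> M \<simeq> Resistor (R + R1) \<oplus> X" unfolding X(1) by (rule Resistor_merge[OF R X(2)])
    ultimately show ?thesis using RLC_eqv R M(2) by auto
  next
    case 5
    then show ?thesis using R by (rule Resistor_series_N8)
  next
    case 6
    then have "freq_inverse M \<in> N8" by (auto simp: N9_def intro!: N8I)
    from freq_inverse_RLC[OF Resistor_series_N8[OF this R]] show ?thesis by simp
  qed
qed

section \<open>Connections of an RL network with an RC network\<close>

lemma RLC_Foster_aux:
  assumes pos: "0 \<le> G1" "0 < L" "0 \<le> G2" "0 < C" and le: "G1 \<le> G2"
  shows "(Conductor G1 \<parallel> Inductor L) \<oplus> (Conductor G2 \<parallel> Capacitor C) \<in> RLC_networks" (is "?N \<in> _")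
proof (rule RLC_biquadratic)
  show "biquadratic ?N (L * C) (L * (G1 + G2)) 1 (G1 * L * C) (C + G1 * G2 * L) G2"
    unfolding biquadratic_def
  proof (intro conjI allI impI)
    fix s :: real assume s: "0 < s"
    have "ratio (val ?N s) (L * s * (G2 * 1 + C * s) + 1 * (G1 * (L * s) + 1)) ((G1 * (L * s) + 1) * (G2 * 1 + C * s))"
      unfolding val.simps(5)
      by (intro ratio_add ratio_rules s pos add_pos_pos[OF add_nonneg_pos add_nonneg_pos]) (use s pos in auto)
    then show "ratio (val ?N s) (L * C * s\<^sup>2 + L * (G1 + G2) * s + 1) (G1 * L * C * s\<^sup>2 + (C + G1 * G2 * L) * s + G2)"
      by (rule ratio_subst) (simp_all add: algebra_simps power2_eq_square)
  qed (use pos in auto)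
  have q: "L * C * G2 - 1 * (G1 * L * C) = L * C * (G2 - G1)" by (simp add: algebra_simps)
  have p: "L * C * (C + G1 * G2 * L) - L * (G1 + G2) * (G1 * L * C) = L * C * (C - G1\<^sup>2 * L)"
    by (simp add: algebra_simps power2_eq_square)
  have r: "L * (G1 + G2) * G2 - 1 * (C + G1 * G2 * L) = L * G2\<^sup>2 - C"
    by (simp add: algebra_simps power2_eq_square)
  \<comment> \<open>The resultant is a positive multiple of a square.\<close>
  have "(L * C * (G2 - G1))\<^sup>2 - L * C * (C - G1\<^sup>2 * L) * (L * G2\<^sup>2 - C) = L * C * (C - G1 * G2 * L)\<^sup>2"
    by (simp add: algebra_simps power2_eq_square)
  moreover have "0 \<le> L * C * (C - G1 * G2 * L)\<^sup>2" using pos by simp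
  ultimately show "(L * C * (C + G1 * G2 * L) - L * (G1 + G2) * (G1 * L * C)) * (L * (G1 + G2) * G2 - 1 * (C + G1 * G2 * L))
    \<le> (L * C * G2 - 1 * (G1 * L * C))\<^sup>2"
    unfolding p q r by simp
  have q0: "1 * (G1 * L * C) \<le> L * C * G2"
    using mult_left_mono[OF le, of "L * C"] pos by (simp add: mult_ac)
  \<comment> \<open>The first inequality is equivalent to a minimum of the impedance at 0. If it
    fails, \<open>G1 \<le> G2\<close> bounds \<open>(G1 * G2 * L)\<^sup>2\<close> by
    \<open>G1 * G2 ^ 3 * L\<^sup>2\<close>, hence by \<open>C\<^sup>2\<close>, and the second
    inequality is enough for a minimum of the admittance at infinity.\<close>
  consider "C\<^sup>2 \<le> G1 * G2 ^ 3 * L\<^sup>2" | "G1 * G2 * L \<le> C"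
  proof (cases "C\<^sup>2 \<le> G1 * G2 ^ 3 * L\<^sup>2")
    case False
    have "(G1 * G2 * L)\<^sup>2 = G1 * G2\<^sup>2 * L\<^sup>2 * G1" by algebra
    also have "\<dots> \<le> G1 * G2\<^sup>2 * L\<^sup>2 * G2" using le pos by (intro mult_left_mono) auto
    also have "\<dots> = G1 * G2 ^ 3 * L\<^sup>2" by algebra
    finally have "(G1 * G2 * L)\<^sup>2 \<le> C\<^sup>2" using False by linarith
    then have "G1 * G2 * L \<le> C" using pos(4) by (rule power2_le_imp_le[OF _ less_imp_le])
    with that(2) show ?thesis .
  qed (use that in blast)
  then have "G2 * (L * C * (G2 - G1)) \<le> (C + G1 * G2 * L) * (L * G2\<^sup>2 - C) \<or>
    L * C * (L * C * (G2 - G1)) \<le> L * (G1 + G2) * (L * C * (C - G1\<^sup>2 * L))"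
  proof cases
    case 1
    have "(C + G1 * G2 * L) * (L * G2\<^sup>2 - C) - G2 * (L * C * (G2 - G1)) = G1 * G2 ^ 3 * L\<^sup>2 - C\<^sup>2"
      by (simp add: algebra_simps power2_eq_square power3_eq_cube)
    then show ?thesis using 1 by linarith
  next
    case 2
    have "(G1 + G2) * G1 * L \<le> (G2 + G2) * G1 * L"
      using le pos by (intro mult_right_mono) auto
    then have "(G1 + G2) * G1 * L \<le> 2 * C" using 2 by (simp add: algebra_simps)
    then have "0 \<le> L\<^sup>2 * C * G1 * (2 * C - (G1 + G2) * G1 * L)" using pos by simp
    also have "\<dots> = L * (G1 + G2) * (L * C * (C - G1\<^sup>2 * L)) - L * C * (L * C * (G2 - G1))"
      by (simp add: algebra_simps power2_eq_square)
    finally show ?thesis by simp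
  qed
  then show "1 * (G1 * L * C) \<le> L * C * G2 \<and>
      G2 * (L * C * G2 - 1 * (G1 * L * C)) \<le> (C + G1 * G2 * L) * (L * (G1 + G2) * G2 - 1 * (C + G1 * G2 * L)) \<or>
    1 * (G1 * L * C) \<le> L * C * G2 \<and>
      L * C * (L * C * G2 - 1 * (G1 * L * C)) \<le> L * (G1 + G2) * (L * C * (C + G1 * G2 * L) - L * (G1 + G2) * (G1 * L * C)) \<or>
    L * C * G2 \<le> 1 * (G1 * L * C) \<and>
      (C + G1 * G2 * L) * (L * C * (C + G1 * G2 * L) - L * (G1 + G2) * (G1 * L * C)) \<le> G1 * L * C * (L * C * G2 - 1 * (G1 * L * C)) \<or>
    L * C * G2 \<le> 1 * (G1 * L * C) \<and>
      L * (G1 + G2) * (L * (G1 + G2) * G2 - 1 * (C + G1 * G2 * L)) \<le> 1 * (L * C * G2 - 1 * (G1 * L * C))"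
    using q0 unfolding p q r by argo
qed

text \<open>Frequency inversion turns the inductor into a capacitor and conversely, so it
  interchanges the roles of \<open>G1\<close> and \<open>G2\<close>.\<close>

lemma RLC_Foster:
  assumes pos: "0 \<le> G1" "0 < L" "0 \<le> G2" "0 < C"
  shows "(Conductor G1 \<parallel> Inductor L) \<oplus> (Conductor G2 \<parallel> Capacitor C) \<in> RLC_networks"
proof (cases "G1 \<le> G2")
  case True
  then show ?thesis using RLC_Foster_aux assms by simp
next
  case False
  then have "(Conductor G2 \<parallel> Inductor (1 / C)) \<oplus> (Conductor G1 \<parallel> Capacitor (1 / L)) \<in> RLC_networks"
    using assms by (intro RLC_Foster_aux) auto
  from freq_inverse_RLC[OF this]
  have "(Conductor G2 \<parallel> Capacitor C) \<oplus> (Conductor G1 \<parallel> Inductor L) \<in> RLC_networks" by simp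
  then show ?thesis by (rule RLC_eqv) (use pos in \<open>auto simp: eqv_def add_ac\<close>)
qed

lemma RC_series_RL:
  assumes "N \<in> RC_networks" "M \<in> RL_networks" shows "N \<oplus> M \<in> RLC_networks"
proof -
  have *: "N \<oplus> M \<in> RLC_networks" if NM: "N \<in> one_storage capacitors" "M \<in> one_storage inductors"
    "N \<in> series_parallel" "M \<in> series_parallel" for N M
  proof -
    consider "N \<in> resistive" | "M \<in> resistive" | "N \<notin> resistive" "M \<notin> resistive" by blast
    then show ?thesis
    proof cases
      case 1
      then have "N \<oplus> M \<in> RL_networks"
        using NM by (intro admissible_resistive_series[OF admissible_RL]) (auto intro: eqv_closure_base)
      then show ?thesis using RL_subset_RLC by blast
    next
      case 2
      then have "M \<oplus> N \<in> RC_networks"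
        using NM by (intro admissible_resistive_series[OF admissible_RC]) (auto intro: eqv_closure_base)
      then have "N \<oplus> M \<in> RC_networks"
        using NM by (elim eqv_closure_eqv) (auto simp: eqv_def add_ac)
      then show ?thesis using RC_subset_RLC by blast
    next
      case 3
      then obtain R G C R' G' L where
        N: "N = Resistor R \<oplus> (Conductor G \<parallel> Capacitor C)" "0 \<le> R" "0 \<le> G" "0 < C" and
        M: "M = Resistor R' \<oplus> (Conductor G' \<parallel> Inductor L)" "0 \<le> R'" "0 \<le> G'" "0 < L"
        using NM by (auto simp: one_storage_def inductors_def capacitors_def)
      have "Resistor R \<oplus> (Resistor R' \<oplus> ((Conductor G' \<parallel> Inductor L) \<oplus> (Conductor G \<parallel> Capacitor C))) \<in> RLC_networks"
        using N M by (intro admissible_Resistor_series[OF admissible_RLC] RLC_Foster)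
      then show ?thesis
        by (rule RLC_eqv) (use N M in \<open>auto simp: eqv_def add_ac\<close>)
    qed
  qed
  show ?thesis
    unfolding RLC_networks_def
    by (rule series_eqv_closure[OF _ assms]) (use * in \<open>simp add: RLC_networks_def\<close>)
qed

lemma RC_parallel_RL: "N \<in> RC_networks \<Longrightarrow> M \<in> RL_networks \<Longrightarrow> N \<parallel> M \<in> RLC_networks"
  by (rule parallel_from_series[of RC_networks RL_networks])
     (auto intro: RC_series_RL admissible_p_trans admissible_RL admissible_RC admissible_RLC)

lemma scale_RLC:
  assumes "N \<in> RLC_networks" "0 < k" shows "scale k N \<in> RLC_networks"
proof -
  have *: "scale k M \<in> RLC_networks"
    if "M \<in> one_storage inductors \<union> one_storage capacitors \<union> N6 \<union> N7 \<union> N8 \<union> N9" "M \<in> series_parallel" for M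
    using that
  proof (cases rule: RLC_cases)
    case 1 then show ?thesis using scale_RL assms(2) RL_subset_RLC by blast
  next
    case 2 then show ?thesis using scale_RC assms(2) RC_subset_RLC by blast
  next
    case 3
    have "scale k M \<in> N6" using 3[unfolded N6_def] assms(2) by (auto intro!: N6I)
    then show ?thesis using N6_to_N9_subset_RLC by blast
  next
    case 4
    have "scale k M \<in> N7" using 4[unfolded N7_def] assms(2) by (auto intro!: N7I)
    then show ?thesis using N6_to_N9_subset_RLC by blast
  next
    case 5
    have "scale k M \<in> N8" using 5[unfolded N8_def] assms(2) by (auto intro!: N8I)
    then show ?thesis using N6_to_N9_subset_RLC by blast
  next
    case 6
    have "scale k M \<in> N9" using 6[unfolded N9_def] assms(2) by (auto intro!: N9I)
    then show ?thesis using N6_to_N9_subset_RLC by blast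
  qed
  show ?thesis
    unfolding RLC_networks_def
    by (rule scale_eqv_closure[OF _ assms(2) assms(1)[unfolded RLC_networks_def]])
       (use * in \<open>simp add: RLC_networks_def\<close>)
qed


section \<open>Networks with two inductors and one capacitor\<close>

text \<open>The common shape of \<open>N10\<close> to \<open>N14\<close>: a storage element with its
  own series resistor, shunting a network from a class \<open>S\<close> that is already
  understood.\<close>

definition branch :: "network set \<Rightarrow> network set \<Rightarrow> network set" where
  "branch B S = {Resistor R \<oplus> ((Resistor R' \<oplus> X) \<parallel> Y) | R R' X Y.
     0 \<le> R \<and> 0 \<le> R' \<and> X \<in> B \<and> Y \<in> S}"

lemma branch_closureI:
  "0 \<le> R \<Longrightarrow> 0 \<le> R' \<Longrightarrow> X \<in> B \<Longrightarrow> Y \<in> S \<Longrightarrow> X \<in> series_parallel \<Longrightarrow> Y \<in> series_parallel \<Longrightarrow>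
    Resistor R \<oplus> ((Resistor R' \<oplus> X) \<parallel> Y) \<in> eqv_closure (branch B S)"
  by (rule eqv_closure_base) (auto simp: branch_def)

lemma branch_Resistor_series:
  assumes "M \<in> branch B S" "M \<in> series_parallel" "0 \<le> R"
  shows "Resistor R \<oplus> M \<in> eqv_closure (branch B S)"
proof -
  obtain R4 R5 X Y where M: "M = Resistor R4 \<oplus> ((Resistor R5 \<oplus> X) \<parallel> Y)" "0 \<le> R4" "0 \<le> R5" "X \<in> B" "Y \<in> S"
    using assms(1) by (auto simp: branch_def)
  have "Resistor R \<oplus> M \<simeq> Resistor (R + R4) \<oplus> ((Resistor R5 \<oplus> X) \<parallel> Y)"
    unfolding M(1) using assms(3) M(2) by (rule Resistor_merge)
  moreover have "Resistor (R + R4) \<oplus> ((Resistor R5 \<oplus> X) \<parallel> Y) \<in> eqv_closure (branch B S)"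
    by (rule branch_closureI) (use M assms in auto)
  ultimately show ?thesis
    using assms(2,3) by (blast intro: eqv_closure_eqv series_parallel.intros(1,5))
qed

text \<open>After the exchange with the outer resistor the conductor lies in parallel with
  \<open>Y\<close>, and the admissible class \<open>S\<close> absorbs it. No canonical form of the
  whole network is needed.\<close>

lemma branch_Conductor_parallel:
  assumes "M \<in> branch B S" "M \<in> series_parallel" "0 \<le> G" and S: "admissible S"
    and scB: "\<And>X k. X \<in> B \<Longrightarrow> 0 < k \<Longrightarrow> scale k X \<in> B" and scS: "\<And>Y k. Y \<in> S \<Longrightarrow> 0 < k \<Longrightarrow> scale k Y \<in> S"
  shows "Conductor G \<parallel> M \<in> eqv_closure (branch B S)"
proof -
  obtain R4 R5 X Y where M: "M = Resistor R4 \<oplus> ((Resistor R5 \<oplus> X) \<parallel> Y)" "0 \<le> R4" "0 \<le> R5" "X \<in> B" "Y \<in> S"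
    using assms(1) by (auto simp: branch_def)
  have sp: "X \<in> series_parallel" "Y \<in> series_parallel" using assms(2) M(1) by auto
  define D where "D = 1 + G * R4"
  define k where "k = 1 / D\<^sup>2"
  have D: "0 < D" unfolding D_def using M assms(3) by (simp add: add_pos_nonneg)
  then have k: "0 < k" by (simp add: k_def)
  have "Conductor G \<parallel> M \<simeq>
      Resistor (R4 / D) \<oplus> (Conductor (G * D) \<parallel> ((Resistor (k * R5) \<oplus> scale k X) \<parallel> scale k Y))"
    using Conductor_Resistor_exchange[of "(Resistor R5 \<oplus> X) \<parallel> Y" R4 G] M sp assms(3)
    by (simp add: D_def[symmetric] k_def[symmetric])
  also have "\<dots> \<simeq> Resistor (R4 / D) \<oplus> ((Resistor (k * R5) \<oplus> scale k X) \<parallel> (Conductor (G * D) \<parallel> scale k Y))"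
    by (intro eqv_series eqv_refl parallel_left_commute)
  finally have "Conductor G \<parallel> M \<simeq>
      Resistor (R4 / D) \<oplus> ((Resistor (k * R5) \<oplus> scale k X) \<parallel> (Conductor (G * D) \<parallel> scale k Y))" .
  moreover have "Conductor (G * D) \<parallel> scale k Y \<in> S"
    using D assms(3) by (intro admissible_Conductor_parallel[OF S] scS M(5) k) simp
  then have "Resistor (R4 / D) \<oplus> ((Resistor (k * R5) \<oplus> scale k X) \<parallel> (Conductor (G * D) \<parallel> scale k Y))
      \<in> eqv_closure (branch B S)"
    by (rule branch_closureI[rotated 3]) (use M D k sp assms(3) scB in auto)
  ultimately show ?thesis
    using assms(2,3) by (blast intro: eqv_closure_eqv series_parallel.intros(6) Conductor_series_parallel)
qed

text \<open>In the form with the conductor outermost, the conductor of \<open>N\<close> is handed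
  over to \<open>M\<close>. What is left of \<open>N\<close> is the resistor and storage element of
  a branch whose outer resistor is 0.\<close>

lemma one_storage_parallel_branch:
  assumes N: "N \<in> eqv_closure (one_storage B)" and M: "M \<in> S" and S: "admissible S"
    and B: "admissible (eqv_closure (one_storage B))" "\<And>X. X \<in> B \<Longrightarrow> p_trans X \<in> B"
  shows "N \<parallel> M \<in> S \<union> eqv_closure (branch B S)"
proof -
  have sp: "N \<in> series_parallel" "M \<in> series_parallel"
    using N M S eqv_closure_series_parallel admissible_series_parallel by auto
  show ?thesis
  proof (cases "N \<in> eqv_closure resistive")
    case True
    then obtain N' where N': "N' \<in> resistive" "N \<simeq> N'" by (rule eqv_closureE)
    have "N' \<parallel> M \<in> S" by (rule admissible_resistive_parallel[OF S N'(1) M])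
    then have "N \<parallel> M \<in> S"
      by (rule admissible_eqv[OF S]) (use N' sp in \<open>auto intro: eqv_parallel\<close>)
    then show ?thesis by simp
  next
    case False
    from p_trans_one_storage[OF B(1) N False] obtain R G X where
      X: "0 \<le> R" "0 \<le> G" "X \<in> B" "X \<in> series_parallel" and
      eq: "N \<simeq> Conductor G \<parallel> (Resistor R \<oplus> p_trans X)" .
    have "N \<parallel> M \<simeq> (Conductor G \<parallel> (Resistor R \<oplus> p_trans X)) \<parallel> M"
      by (intro eqv_parallel eq eqv_refl)
    also have "\<dots> \<simeq> Resistor 0 \<oplus> ((Resistor R \<oplus> p_trans X) \<parallel> (Conductor G \<parallel> M))"
      by (simp add: eqv_def add_ac)
    finally have "N \<parallel> M \<simeq> Resistor 0 \<oplus> ((Resistor R \<oplus> p_trans X) \<parallel> (Conductor G \<parallel> M))" .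
    moreover have "Resistor 0 \<oplus> ((Resistor R \<oplus> p_trans X) \<parallel> (Conductor G \<parallel> M)) \<in> eqv_closure (branch B S)"
      using X sp B(2) admissible_Conductor_parallel[OF S M] by (intro branch_closureI) auto
    ultimately have "N \<parallel> M \<in> eqv_closure (branch B S)"
      using sp by (blast intro: eqv_closure_eqv series_parallel.intros(6))
    then show ?thesis by simp
  qed
qed

definition branches :: "network set" where
  "branches = branch inductors RLC_networks \<union> branch capacitors RLL_networks"

definition RLLC_networks :: "network set" where
  "RLLC_networks = eqv_closure (RLL_networks \<union> RLC_networks \<union> branches \<union> p_trans ` branches)"

lemma RLC_series_parallel: "RLC_networks \<subseteq> series_parallel"
  unfolding RLC_networks_def by (rule eqv_closure_subset)

lemma RLL_series_parallel: "RLL_networks \<subseteq> series_parallel"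
  unfolding RLL_networks_def by (rule eqv_closure_subset)

lemma branches_series_parallel: "branches \<subseteq> series_parallel"
  using RLC_series_parallel RLL_series_parallel
  by (auto simp: branches_def branch_def inductors_def capacitors_def)

lemma subset_RLLC:
  "RLL_networks \<subseteq> RLLC_networks" "RLC_networks \<subseteq> RLLC_networks"
  "eqv_closure branches \<subseteq> RLLC_networks" "eqv_closure (p_trans ` branches) \<subseteq> RLLC_networks"
proof -
  have "eqv_closure RLL_networks \<subseteq> RLLC_networks" "eqv_closure RLC_networks \<subseteq> RLLC_networks"
    unfolding RLLC_networks_def by (auto intro!: eqv_closure_mono)
  then show "RLL_networks \<subseteq> RLLC_networks" "RLC_networks \<subseteq> RLLC_networks"
    by (simp_all add: RLL_networks_def RLC_networks_def)
  show "eqv_closure branches \<subseteq> RLLC_networks" "eqv_closure (p_trans ` branches) \<subseteq> RLLC_networks"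
    unfolding RLLC_networks_def by (auto intro!: eqv_closure_mono)
qed

lemma branches_Resistor_series:
  "M \<in> branches \<Longrightarrow> 0 \<le> R \<Longrightarrow> Resistor R \<oplus> M \<in> eqv_closure branches"
  using branch_Resistor_series[of M] branches_series_parallel eqv_closure_mono
  unfolding branches_def by (metis Un_iff subsetD sup_ge1 sup_ge2)

lemma branches_Conductor_parallel:
  assumes M: "M \<in> branches" and G: "0 \<le> G" shows "Conductor G \<parallel> M \<in> eqv_closure branches"
proof -
  have sp: "M \<in> series_parallel" using M branches_series_parallel by blast
  from M have "Conductor G \<parallel> M \<in> eqv_closure (branch inductors RLC_networks) \<union> eqv_closure (branch capacitors RLL_networks)"
    unfolding branches_def
  proof (elim UnE)
    assume "M \<in> branch inductors RLC_networks"
    then show ?thesis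
      using branch_Conductor_parallel[OF _ sp G admissible_RLC scale_inductors scale_RLC] by blast
  next
    assume "M \<in> branch capacitors RLL_networks"
    then show ?thesis
      using branch_Conductor_parallel[OF _ sp G admissible_RLL scale_capacitors scale_RLL] by blast
  qed
  then show ?thesis
    using eqv_closure_mono unfolding branches_def by (metis Un_iff subsetD sup_ge1 sup_ge2)
qed

text \<open>Closure under \<open>p_trans\<close> holds because the images were added. The price is a
  series resistor on such an image, which is the image of a parallel conductor on a branch.\<close>

lemma admissible_RLLC: "admissible RLLC_networks"
  unfolding RLLC_networks_def
proof (rule admissible_closureI, unfold RLLC_networks_def[symmetric])
  show "Resistor 0 \<in> RLL_networks \<union> RLC_networks \<union> branches \<union> p_trans ` branches"
    using admissible_RLL by (simp add: admissible_def)
next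
  fix M assume M: "M \<in> RLL_networks \<union> RLC_networks \<union> branches \<union> p_trans ` branches" "M \<in> series_parallel"
  then have "p_trans M \<in> RLL_networks \<union> RLC_networks \<union> branches \<union> p_trans ` branches"
    using admissible_p_trans[OF admissible_RLL] admissible_p_trans[OF admissible_RLC] by auto
  then show "p_trans M \<in> RLLC_networks"
    unfolding RLLC_networks_def using M(2) by (intro eqv_closure_base) auto
next
  fix R :: real and M
  assume R: "0 \<le> R" and M: "M \<in> RLL_networks \<union> RLC_networks \<union> branches \<union> p_trans ` branches" "M \<in> series_parallel"
  from M(1) show "Resistor R \<oplus> M \<in> RLLC_networks"
  proof (elim UnE)
    assume "M \<in> p_trans ` branches"
    then obtain M' where M': "M = p_trans M'" "M' \<in> branches" by blast
    have "p_trans (Conductor R \<parallel> M') \<in> eqv_closure (p_trans ` branches)"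
      by (rule p_trans_eqv_closure[OF _ branches_Conductor_parallel[OF M'(2) R]])
         (auto intro: eqv_closure_base)
    then show ?thesis using subset_RLLC(4) by (auto simp: M'(1))
  qed (use R subset_RLLC admissible_Resistor_series[OF admissible_RLL] admissible_Resistor_series[OF admissible_RLC]
        branches_Resistor_series in blast)+
qed

lemma RC_parallel_RLL: "N \<in> RC_networks \<Longrightarrow> M \<in> RLL_networks \<Longrightarrow> N \<parallel> M \<in> RLLC_networks"
  using one_storage_parallel_branch[OF _ _ admissible_RLL admissible_RC p_trans_capacitors]
    subset_RLLC eqv_closure_mono[of "branch capacitors RLL_networks" branches]
  unfolding branches_def by blast

lemma RL_parallel_RLC: "N \<in> RL_networks \<Longrightarrow> M \<in> RLC_networks \<Longrightarrow> N \<parallel> M \<in> RLLC_networks"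
  using one_storage_parallel_branch[OF _ _ admissible_RLC admissible_RL p_trans_inductors]
    subset_RLLC eqv_closure_mono[of "branch inductors RLC_networks" branches]
  unfolding branches_def by blast

lemma RC_series_RLL: "N \<in> RC_networks \<Longrightarrow> M \<in> RLL_networks \<Longrightarrow> N \<oplus> M \<in> RLLC_networks"
  by (rule series_from_parallel[of RC_networks RLL_networks])
     (auto intro: RC_parallel_RLL admissible_p_trans admissible_RC admissible_RLL admissible_RLLC)

lemma RL_series_RLC: "N \<in> RL_networks \<Longrightarrow> M \<in> RLC_networks \<Longrightarrow> N \<oplus> M \<in> RLLC_networks"
  by (rule series_from_parallel[of RL_networks RLC_networks])
     (auto intro: RL_parallel_RLC admissible_p_trans admissible_RL admissible_RLC admissible_RLLC)

section \<open>Classes indexed by the numbers of capacitors and inductors\<close>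

definition network_class :: "nat \<Rightarrow> nat \<Rightarrow> network set" where
  "network_class m n =
    (if m = 0 then if n = 0 then eqv_closure (one_storage {}) else if n = 1 then RL_networks else RLL_networks
     else if n = 0 then RC_networks else if n = 1 then RLC_networks else RLLC_networks)"

lemma admissible_network_class: "admissible (network_class m n)"
  using admissible_one_storage[of "{}"] admissible_RL admissible_RC admissible_RLL admissible_RLC admissible_RLLC
  by (simp add: network_class_def)

lemma network_class_series:
  assumes "m + m' \<le> 1" "n + n' \<le> 2" "N \<in> network_class m n" "M \<in> network_class m' n'"
  shows "N \<oplus> M \<in> network_class (m + m') (n + n')"
proof -
  \<comment> \<open>Up to the order of the two networks, these are all ways to split at most one
    capacitor and at most two inductors between them.\<close>
  have *: "N \<oplus> M \<in> network_class (m + m') (n + n')"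
    if "m = 0 \<and> n = 0 \<or> m = 0 \<and> n = 1 \<and> m' = 0 \<and> n' = 1 \<or> m = 1 \<and> n = 0 \<and> m' = 0 \<and> n' = 1 \<or>
      m = 1 \<and> n = 0 \<and> m' = 0 \<and> n' = 2 \<or> m = 0 \<and> n = 1 \<and> m' = 1 \<and> n' = 1"
      "N \<in> network_class m n" "M \<in> network_class m' n'" for N M m n m' n'
    using that(1)
  proof (elim disjE conjE)
    assume 0: "m = 0" "n = 0"
    then have "N \<in> eqv_closure resistive"
      using that(2) by (simp add: network_class_def one_storage_def)
    then obtain N' where N': "N' \<in> resistive" "N \<simeq> N'" "N \<in> series_parallel" by (rule eqv_closureE)
    have M: "M \<in> series_parallel"
      by (rule admissible_series_parallel[OF admissible_network_class that(3)])
    have "N' \<oplus> M \<in> network_class m' n'"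
      by (rule admissible_resistive_series[OF admissible_network_class N'(1) that(3)])
    then have "N \<oplus> M \<in> network_class m' n'"
      by (rule admissible_eqv[OF admissible_network_class]) (use N' M in \<open>auto intro: eqv_series\<close>)
    then show ?thesis using 0 by simp
  qed (use that RL_series_RL RC_series_RL RC_series_RLL RL_series_RLC in \<open>auto simp: network_class_def\<close>)
  have "(m = 0 \<and> n = 0 \<or> m = 0 \<and> n = 1 \<and> m' = 0 \<and> n' = 1 \<or> m = 1 \<and> n = 0 \<and> m' = 0 \<and> n' = 1 \<or>
      m = 1 \<and> n = 0 \<and> m' = 0 \<and> n' = 2 \<or> m = 0 \<and> n = 1 \<and> m' = 1 \<and> n' = 1) \<or>
    (m' = 0 \<and> n' = 0 \<or> m' = 0 \<and> n' = 1 \<and> m = 0 \<and> n = 1 \<or> m' = 1 \<and> n' = 0 \<and> m = 0 \<and> n = 1 \<or>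
      m' = 1 \<and> n' = 0 \<and> m = 0 \<and> n = 2 \<or> m' = 0 \<and> n' = 1 \<and> m = 1 \<and> n = 1)"
    using assms(1,2) by presburger
  then show ?thesis
  proof
    assume "m' = 0 \<and> n' = 0 \<or> m' = 0 \<and> n' = 1 \<and> m = 0 \<and> n = 1 \<or> m' = 1 \<and> n' = 0 \<and> m = 0 \<and> n = 1 \<or>
      m' = 1 \<and> n' = 0 \<and> m = 0 \<and> n = 2 \<or> m' = 0 \<and> n' = 1 \<and> m = 1 \<and> n = 1"
    then have "M \<oplus> N \<in> network_class (m' + m) (n' + n)" by (rule *) (use assms in auto)
    then have "N \<oplus> M \<in> network_class (m' + m) (n' + n)"
      by (rule admissible_eqv[OF admissible_network_class])
         (use assms admissible_series_parallel[OF admissible_network_class] in \<open>auto simp: eqv_def add_ac\<close>)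
    then show ?thesis by (simp add: add_ac)
  qed (use * assms in blast)
qed

lemma network_class_parallel:
  assumes "m + m' \<le> 1" "n + n' \<le> 2" "N \<in> network_class m n" "M \<in> network_class m' n'"
  shows "N \<parallel> M \<in> network_class (m + m') (n + n')"
  by (rule parallel_from_series[of "network_class m n" "network_class m' n'"])
     (use assms in \<open>auto intro: network_class_series admissible_p_trans admissible_network_class\<close>)

lemma series_parallel_network_class:
  "N \<in> series_parallel \<Longrightarrow> num_capacitors N \<le> 1 \<Longrightarrow> num_inductors N \<le> 2 \<Longrightarrow>
    N \<in> network_class (num_capacitors N) (num_inductors N)"
proof (induction rule: series_parallel.induct)
  case (1 R)
  then show ?case using admissible_resistive[OF admissible_network_class[of 0 0]] by (auto simp: resistive_def)
next
  case 2
  then show ?case using admissible_resistive[OF admissible_network_class[of 0 0]] by (auto simp: resistive_def)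
next
  case (3 L)
  then show ?case by (simp add: network_class_def Inductor_RL)
next
  case (4 C)
  then show ?case by (simp add: network_class_def Capacitor_RC)
next
  case (5 N N')
  then show ?case using network_class_series[of "num_capacitors N" "num_capacitors N'"] by simp
next
  case (6 N N')
  then show ?case using network_class_parallel[of "num_capacitors N" "num_capacitors N'"] by simp
qed

lemma network_class_subset_RLLC: "network_class m n \<subseteq> RLLC_networks"
proof -
  have "eqv_closure (one_storage {}) \<subseteq> RL_networks"
    by (intro eqv_closure_mono) (auto simp: one_storage_def)
  then show ?thesis
    using subset_RLLC RL_subset_RLL RC_subset_RLC by (auto simp: network_class_def)
qed

section \<open>Reduction to the listed networks\<close>

lemma branches_cases:
  assumes "M \<in> branches"
  shows "M \<in> RLL_networks \<union> RLC_networks \<union> eqv_closure (N10 \<union> N11 \<union> N12 \<union> N13 \<union> N14)" (is "_ \<in> ?T")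
proof -
  have sp: "M \<in> series_parallel" using assms branches_series_parallel by blast
  have T: "N \<in> ?T" if "N \<simeq> N'" "N' \<in> ?T" "N \<in> series_parallel" for N N'
    using that RLL_eqv RLC_eqv eqv_closure_eqv by blast
  from assms show ?thesis
    unfolding branches_def
  proof (elim UnE)
    assume "M \<in> branch inductors RLC_networks"
    then obtain R4 R5 L Y where M: "M = Resistor R4 \<oplus> ((Resistor R5 \<oplus> Inductor L) \<parallel> Y)"
      and pos: "0 \<le> R4" "0 \<le> R5" "0 < L" and Y: "Y \<in> RLC_networks"
      by (auto simp: branch_def inductors_def)
    from Y obtain Y' where Y': "Y \<simeq> Y'" "Y' \<in> series_parallel"
      "Y' \<in> one_storage inductors \<union> one_storage capacitors \<union> N6 \<union> N7 \<union> N8 \<union> N9"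
      unfolding RLC_networks_def by (rule eqv_closureE)
    have X: "Resistor R5 \<oplus> Inductor L \<in> RL_networks"
      by (intro admissible_Resistor_series[OF admissible_RL] Inductor_RL pos)
    have "M \<simeq> Resistor R4 \<oplus> ((Resistor R5 \<oplus> Inductor L) \<parallel> Y')"
      unfolding M by (intro eqv_series eqv_parallel eqv_refl Y')
    moreover have "Resistor R4 \<oplus> ((Resistor R5 \<oplus> Inductor L) \<parallel> Y') \<in> ?T"
      using Y'(3,2)
    proof (cases rule: RLC_cases)
      \<comment> \<open>In the first two cases \<open>Y'\<close> has at most one storage element, so
        the branch falls into a class with two. The classes \<open>N6\<close> to \<open>N9\<close>
        lead to \<open>N10\<close> to \<open>N13\<close> in turn.\<close>
      case 1
      then show ?thesis using RL_parallel_RL[OF X] admissible_Resistor_series[OF admissible_RLL _ pos(1)] by blast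
    next
      case 2
      have "Y' \<parallel> (Resistor R5 \<oplus> Inductor L) \<in> RLC_networks" by (rule RC_parallel_RL[OF 2 X])
      then have "(Resistor R5 \<oplus> Inductor L) \<parallel> Y' \<in> RLC_networks"
        by (rule RLC_eqv) (use pos Y' in \<open>auto simp: eqv_def add_ac\<close>)
      then show ?thesis using admissible_Resistor_series[OF admissible_RLC _ pos(1)] by blast
    next
      case 3
      then have "Resistor R4 \<oplus> ((Resistor R5 \<oplus> Inductor L) \<parallel> Y') \<in> N10"
        using pos unfolding N6_def N10_def by blast
      then show ?thesis using pos Y' by (auto intro: eqv_closure_base)
    next
      case 4
      then have "Resistor R4 \<oplus> ((Resistor R5 \<oplus> Inductor L) \<parallel> Y') \<in> N11"
        using pos unfolding N7_def N11_def by blast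
      then show ?thesis using pos Y' by (auto intro: eqv_closure_base)
    next
      case 5
      then obtain G K where K: "Y' = Conductor G \<parallel> K"
        "Resistor R4 \<oplus> ((Resistor R5 \<oplus> Inductor L) \<parallel> Conductor G \<parallel> K) \<in> N12" "0 \<le> G"
        using pos unfolding N8_def N12_def by blast
      then have "Resistor R4 \<oplus> ((Resistor R5 \<oplus> Inductor L) \<parallel> Conductor G \<parallel> K) \<in> ?T"
        using pos Y' by (auto intro: eqv_closure_base)
      \<comment> \<open>In \<open>N12\<close> the conductor is grouped with the inductor branch,
        whereas \<open>Y'\<close> groups it with the rest.\<close>
      then show ?thesis
        unfolding K(1)
        by (rule T[rotated]) (use pos Y' K in \<open>auto intro: eqv_series eqv_refl eqv_sym[OF parallel_assoc]\<close>)
    next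
      case 6
      then obtain G K where K: "Y' = Conductor G \<parallel> K"
        "Resistor R4 \<oplus> ((Resistor R5 \<oplus> Inductor L) \<parallel> Conductor G \<parallel> K) \<in> N13" "0 \<le> G"
        using pos unfolding N9_def N13_def by blast
      then have "Resistor R4 \<oplus> ((Resistor R5 \<oplus> Inductor L) \<parallel> Conductor G \<parallel> K) \<in> ?T"
        using pos Y' by (auto intro: eqv_closure_base)
      then show ?thesis
        unfolding K(1)
        by (rule T[rotated]) (use pos Y' K in \<open>auto intro: eqv_series eqv_refl eqv_sym[OF parallel_assoc]\<close>)
    qed
    ultimately show ?thesis using T sp by blast
  next
    assume "M \<in> branch capacitors RLL_networks"
    then obtain R4 R5 C Y where M: "M = Resistor R4 \<oplus> ((Resistor R5 \<oplus> Capacitor C) \<parallel> Y)"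
      and pos: "0 \<le> R4" "0 \<le> R5" "0 < C" and Y: "Y \<in> RLL_networks"
      by (auto simp: branch_def capacitors_def)
    from Y obtain Y' where Y': "Y \<simeq> Y'" "Y' \<in> series_parallel" "Y' \<in> one_storage inductors \<union> N5"
      unfolding RLL_networks_def by (rule eqv_closureE)
    have X: "Resistor R5 \<oplus> Capacitor C \<in> RC_networks"
      by (intro admissible_Resistor_series[OF admissible_RC] Capacitor_RC pos)
    have "M \<simeq> Resistor R4 \<oplus> ((Resistor R5 \<oplus> Capacitor C) \<parallel> Y')"
      unfolding M by (intro eqv_series eqv_parallel eqv_refl Y')
    moreover have "Resistor R4 \<oplus> ((Resistor R5 \<oplus> Capacitor C) \<parallel> Y') \<in> ?T"
      using Y'(3)
    proof
      assume "Y' \<in> one_storage inductors"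
      then have "Y' \<in> RL_networks" using Y'(2) by (rule eqv_closure_base)
      then show ?thesis using RC_parallel_RL[OF X] admissible_Resistor_series[OF admissible_RLC _ pos(1)] by blast
    next
      assume "Y' \<in> N5"
      then have "Resistor R4 \<oplus> ((Resistor R5 \<oplus> Capacitor C) \<parallel> Y') \<in> N14"
        using pos unfolding N5_def N14_def by blast
      then show ?thesis using pos Y' by (auto intro: eqv_closure_base)
    qed
    ultimately show ?thesis using T sp by blast
  qed
qed

definition generators :: "network set" where
  "generators = N1 \<union> N2 \<union> N3 \<union> N5 \<union> N6 \<union> N7 \<union> N8 \<union> N9 \<union> N10 \<union> N11 \<union> N12 \<union> N13 \<union> N14 \<union>
     p_trans ` N10 \<union> p_trans ` N11 \<union> p_trans ` N12 \<union> p_trans ` N13 \<union> p_trans ` N14"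

lemma generators_series_parallel: "generators \<subseteq> series_parallel"
proof -
  have "N10 \<union> N11 \<union> N12 \<union> N13 \<union> N14 \<subseteq> series_parallel"
    by (auto simp: N10_def N11_def N12_def N13_def N14_def)
  moreover have "N1 \<union> N2 \<union> N3 \<union> N5 \<union> N6 \<union> N7 \<union> N8 \<union> N9 \<subseteq> series_parallel"
    by (auto simp: N1_def N2_def N3_def N5_def N6_def N7_def N8_def N9_def)
  ultimately show ?thesis
    unfolding generators_def by auto
qed

lemma generators_num_storage: "N \<in> generators \<Longrightarrow> num_storage N \<le> 3"
proof -
  have C: "num_inductors (Conductor G) = 0" "num_capacitors (Conductor G) = 0" for G
    by (simp_all add: Conductor_def)
  have "num_storage N \<le> 3" if "N \<in> N10 \<union> N11 \<union> N12 \<union> N13 \<union> N14" for N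
    using that by (auto simp: num_storage_def C N10_def N11_def N12_def N13_def N14_def)
  moreover have "num_storage N \<le> 3" if "N \<in> N1 \<union> N2 \<union> N3 \<union> N5 \<union> N6 \<union> N7 \<union> N8 \<union> N9" for N
    using that by (auto simp: num_storage_def C N1_def N2_def N3_def N5_def N6_def N7_def N8_def N9_def)
  ultimately show "N \<in> generators \<Longrightarrow> num_storage N \<le> 3"
    unfolding generators_def by auto
qed

text \<open>The open circuit has to be carried along because the reduction is closed under
  \<open>p_trans\<close>, which sends the short circuit to it, while \<open>N1\<close> contains
  finite resistances only.\<close>

lemma RLLC_subset_generators: "RLLC_networks \<subseteq> eqv_closure (generators \<union> {Open_Circuit})" (is "_ \<subseteq> ?G")
proof -
  have "one_storage inductors \<subseteq> generators \<union> {Open_Circuit}" "one_storage capacitors \<subseteq> generators \<union> {Open_Circuit}"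
    by (auto simp: one_storage_def resistive_def inductors_def capacitors_def generators_def N1_def N2_def N3_def)
  then have RLL: "RLL_networks \<subseteq> ?G" and RLC: "RLC_networks \<subseteq> ?G"
    unfolding RLL_networks_def RLC_networks_def by (auto intro!: eqv_closure_mono simp: generators_def)
  have K: "eqv_closure (N10 \<union> N11 \<union> N12 \<union> N13 \<union> N14) \<subseteq> ?G"
    "eqv_closure (p_trans ` (N10 \<union> N11 \<union> N12 \<union> N13 \<union> N14)) \<subseteq> ?G"
    by (rule eqv_closure_mono; auto simp: generators_def)+
  have B: "branches \<subseteq> ?G" using branches_cases RLL RLC K by blast
  have "p_trans ` branches \<subseteq> ?G"
  proof
    fix N assume "N \<in> p_trans ` branches"
    then obtain M where M: "N = p_trans M" "M \<in> branches" by blast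
    have "p_trans M \<in> eqv_closure (p_trans ` (N10 \<union> N11 \<union> N12 \<union> N13 \<union> N14))"
      if "M \<in> eqv_closure (N10 \<union> N11 \<union> N12 \<union> N13 \<union> N14)"
      by (rule p_trans_eqv_closure[OF _ that]) (auto intro: eqv_closure_base)
    then show "N \<in> ?G"
      using branches_cases[OF M(2)] RLL RLC K
        admissible_p_trans[OF admissible_RLL] admissible_p_trans[OF admissible_RLC] by (auto simp: M(1))
  qed
  then show ?thesis
    unfolding RLLC_networks_def using RLL RLC B by (intro eqv_closure_least) auto
qed

theorem theorem15:
  shows "generating_set
    (N1 \<union> N2 \<union> N3 \<union> N5 \<union> N6 \<union> N7 \<union> N8 \<union> N9 \<union> N10 \<union> N11 \<union> N12 \<union> N13 \<union> N14 \<union>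
     p_trans ` N10 \<union> p_trans ` N11 \<union> p_trans ` N12 \<union> p_trans ` N13 \<union> p_trans ` N14) 1 2"
  unfolding generators_def[symmetric] generating_set_def
proof (intro conjI ballI)
  show "generators \<subseteq> series_parallel" by (rule generators_series_parallel)
next
  fix N assume "N \<in> generators"
  from generators_num_storage[OF this] show "num_storage N \<le> 1 + 2" by linarith
next
  fix Z assume "Z \<in> impedance_set 1 2"
  then obtain N where N: "N \<in> series_parallel" "num_capacitors N \<le> 1" "num_inductors N \<le> 2" "impedance N = Some Z"
    by (auto simp: impedance_set_def)
  then have "N \<in> eqv_closure (generators \<union> {Open_Circuit})"
    using series_parallel_network_class network_class_subset_RLLC RLLC_subset_generators by blast
  then obtain M where M: "M \<in> generators \<union> {Open_Circuit}" "N \<simeq> M" "M \<in> series_parallel"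
    by (rule eqv_closureE)
  have "impedance M = Some Z"
    using eqv_imp_impedance_eq[OF N(1) M(3,2)] N(4) by simp
  \<comment> \<open>The open circuit is ruled out because its impedance is infinite, whereas
    \<open>Z\<close> is finite.\<close>
  with M(1) show "\<exists>N\<in>generators. impedance N = Some Z" by auto
qed

end
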